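(* For $f\in\mathcal U$ (and test functions $v\in\mathcal U$), $$\big\|\langle f,J_{\mathcal U}\,\cdot\,\rangle_h-\langle f,\cdot\rangle_\varepsilon\big\|_{\mathcal U^{-1,2}}\ \le\ \Big\{\sum_{k\in\mathcal K_c}(\eta^f_k)^2\Big\}^{1/2}=:\mathscr E_{\rm ext}(f),$$ where $$\eta^f_k=\Big\{\tfrac1{128}\big[\varepsilon^3(f'_{\ell_{k-1}+1})^2+\varepsilon^3(f'_{\ell_k+1})^2\big]^2+\tilde h_k^2\sum_{j\in\mathcal D^2_k}\bar\varepsilon^r_j|f^r_j|^2+\tfrac1{64}(n\varepsilon)^4\hat h_k^4\sum_{j\in\mathcal D_k^2}\bar\varepsilon^r_j|(f^r)''_j|^2+\hat h_k^4\sum_{j\in\mathcal D^1_k}\varepsilon^r_j|(f^r)'_j|^2\Big\}^{1/2}.$$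
   Context: **Lattice.** $N\in\mathbb N$, $\varepsilon=1/N$; $\mathcal T^\varepsilon$ is the partition of $\mathbb R$ into $[(\ell-1)\varepsilon,\ell\varepsilon]$, $\ell\in\mathbb Z$; $\mathcal P_1(\mathcal T^\varepsilon)$ denotes the functions affine on each element. $\mathcal U=\{u\in\mathcal P_1(\mathcal T^\varepsilon)\cap C^0(\mathbb R):u(x+1)=u(x),\ \int_0^1u\,dx=0\}$. For a functional $T$ on $\mathcal U$, $\|T\|_{\mathcal U^{-1,2}}=\sup\{T[v]:v\in\mathcal U,\ \|v'\|_{L^2[0,1]}=1\}$. $f'_\ell=(f(\ell\varepsilon)-f((\ell-1)\varepsilon))/\varepsilon$. **Regions and mesh.** $\mathbb R$ is decomposed into an atomistic region $\Omega_{\rm a}$, a union of open intervals, and a continuum region $\Omega_c$, a union of closed intervals, with $\Omega_{\rm a}\cup\Omega_c=\mathbb R$; both are 1-periodic, and there is $\delta>2\varepsilon$ with $(0,\delta)\cup(1-\delta,1)\subset\Omega_c$. $\mathcal T^h$ is a partition of $\mathbb R$ with nodes $x^h_{k-1}<x^h_k$ and elements $T_k=[x^h_{k-1},x^h_k]$, $k\in\mathbb Z$; it is periodic, $x^h_{k+K}=x^h_k+1$, and $x^h_1$, $x^h_K$ are the leftmost and rightmost nodes in $[0,1]$. Every lattice point $\ell\varepsilon\in\Omega_{\rm a}$ is a node; every point of $\partial\Omega_c$ is a node; $|T_k|\ge2\varepsilon$ if $T_k\subset\Omega_c$. $\varepsilon^h_k=|T_k|$; $\ell_k=\max\{\ell:\ell\varepsilon\le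 x_k^h\}$. $\mathcal K_c$ is the set of $k\in\{1,\dots,K\}$ with $T_k\cap[0,1]\ne\emptyset$, $T_k\cap(1,\infty)=\emptyset$ and $T_k\subset\Omega_c$. $I_h$ is the continuous piecewise affine nodal interpolation operator on $\mathcal T^h$, and $J_{\mathcal U}v=I_hv-\frac12\sum_{k=1}^K(x^h_{k+1}-x^h_{k-1})v(x^h_k)$ for $v\in\mathcal U$. **Common refinement.** $\mathcal T^r$ is the partition of $\mathbb R$ whose nodes $x^r_j$ (increasing in $j\in\mathbb Z$) are all the nodes of $\mathcal T^\varepsilon$ and $\mathcal T^h$; the node $x^h_k$ is labelled $x^r_{j_k}$; $n=|\{\varepsilon,2\varepsilon,\dots,N\varepsilon\}\cup\{x^h_1,\dots,x^h_K\}|$. $\varepsilon^r_j=x^r_j-x^r_{j-1}$, $\bar\varepsilon^r_j=\frac12(\varepsilon^r_j+\varepsilon^r_{j+1})$, $f^r_j=f(x^r_j)$, $(f^r)'_j=(f^r_j-f^r_{j-1})/\varepsilon^r_j$, $(f^r)''_j=((f^r)'_{j+1}-(f^r)'_j)/\bar\varepsilon^r_j$. $\mathcal D^1_k=\{j_{k-1}+1,\dots,j_k\}$, $\mathcal D^2_k=\{j_{k-1}+1,\dots,j_k-1\}$, $\tilde h_k=\frac12(j_k-j_{k-1})\varepsilon$, $\hat h_k=\Big[\frac{(j_k-j_{k-1})\varepsilon\,((j_k-j_{k-1}+1)\varepsilon)^2}{\varepsilon^h_k}\Big]^{1/2}$. **External energies.** $\langle f,g\rangle_\varepsilon=\sum_{\ell=1}^N\varepsilon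 f(\ell\varepsilon)g(\ell\varepsilon)$ and $\langle f,g\rangle_h=\sum_{k=1}^K\frac12(x^h_{k+1}-x^h_{k-1})f(x^h_k)g(x^h_k)$.
   Formalization: Added assumptions: every mesh node outside the continuum region is a lattice point, and the closed intervals forming that region (itself closed) are nondegenerate. Otherwise an extra non-lattice node deep in the atomistic region makes the left side positive while the estimator is zero. *)

theory Defs
  imports "HOL-Analysis.Analysis"
begin

section \<open>Partitions and the lattice space\<close>

text \<open>A partition of the real line is given by its strictly increasing, integer-indexed nodes \<open>y\<close>;
  its elements are the intervals \<open>{y (k - 1)..y k}\<close>.\<close>

definition element :: "(int \<Rightarrow> real) \<Rightarrow> int \<Rightarrow> real set" where
  "element y k = {y (k - 1)..y k}"

definition P1 :: "(int \<Rightarrow> real) \<Rightarrow> (real \<Rightarrow> real) set" where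
  "P1 y = {u. \<forall>k. \<exists>a b. \<forall>x\<in>element y k. u x = a * x + b}"

definition eps :: "nat \<Rightarrow> real" where
  "eps N = 1 / real N"

definition lattice_pt :: "nat \<Rightarrow> int \<Rightarrow> real" where
  "lattice_pt N l = of_int l * eps N"

definition lattice_space :: "nat \<Rightarrow> (real \<Rightarrow> real) set" where
  "lattice_space N = {u \<in> P1 (lattice_pt N). continuous_on UNIV u \<and>
     (\<forall>x. u (x + 1) = u x) \<and> integral {0..1} u = 0}"

text \<open>The derivative of a piecewise affine function is undefined at its finitely many kinks in
  \<open>{0..1}\<close>; these do not affect the integral.\<close>

definition deriv_norm :: "(real \<Rightarrow> real) \<Rightarrow> real" where
  "deriv_norm v = sqrt (integral {0..1} (\<lambda>x. (deriv v x)\<^sup>2))"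

text \<open>The supremum is taken in the extended reals, so that a bound on it does not depend on the
  value of \<open>Sup\<close> for unbounded sets of reals.\<close>

definition dual_norm :: "nat \<Rightarrow> ((real \<Rightarrow> real) \<Rightarrow> real) \<Rightarrow> ereal" where
  "dual_norm N T = (SUP v\<in>{v \<in> lattice_space N. deriv_norm v = 1}. ereal (T v))"

definition lattice_diff :: "nat \<Rightarrow> (real \<Rightarrow> real) \<Rightarrow> int \<Rightarrow> real" where
  "lattice_diff N f l = (f (lattice_pt N l) - f (lattice_pt N (l - 1))) / eps N"

section \<open>Atomistic and continuum regions, finite element mesh\<close>

text \<open>Closedness of \<open>Oc\<close> only excludes infinite unions of closed intervals that accumulate, such
  as a union filling an open interval. The closed intervals are nondegenerate.\<close>

definition regions :: "nat \<Rightarrow> real set \<Rightarrow> real set \<Rightarrow> bool" where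
  "regions N Oa Oc \<longleftrightarrow>
     (\<exists>I::(real \<times> real) set. (\<forall>(a, b)\<in>I. a < b) \<and> Oa = (\<Union>(a, b)\<in>I. {a<..<b})) \<and>
     (\<exists>I::(real \<times> real) set. (\<forall>(a, b)\<in>I. a < b) \<and> Oc = (\<Union>(a, b)\<in>I. {a..b})) \<and>
     closed Oc \<and>
     Oa \<union> Oc = UNIV \<and>
     (\<forall>x. x + 1 \<in> Oa \<longleftrightarrow> x \<in> Oa) \<and>
     (\<forall>x. x + 1 \<in> Oc \<longleftrightarrow> x \<in> Oc) \<and>
     (\<exists>\<delta>. 2 * eps N < \<delta> \<and> {0<..<\<delta>} \<union> {1 - \<delta><..<1} \<subseteq> Oc)"

text \<open>The mesh nodes in one period are numbered \<open>1, \<dots>, K\<close>. The period is taken half-open,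
  \<open>{0<..1}\<close>, like that of the lattice points with numbers \<open>1, \<dots>, N\<close>: by periodicity,
  \<open>0\<close> is a node iff \<open>1\<close> is one, and then \<open>{0..1}\<close> contains \<open>K + 1\<close> nodes.
  Outside the continuum region the mesh is fully refined: its nodes there are exactly the lattice
  points.\<close>

definition fe_mesh :: "nat \<Rightarrow> nat \<Rightarrow> real set \<Rightarrow> real set \<Rightarrow> (int \<Rightarrow> real) \<Rightarrow> bool" where
  "fe_mesh N K Oa Oc xh \<longleftrightarrow>
     strict_mono xh \<and>
     (\<forall>k. xh (k + int K) = xh k + 1) \<and>
     (\<forall>k. xh k \<in> {0<..1} \<longleftrightarrow> k \<in> {1..int K}) \<and>
     (\<forall>l. lattice_pt N l \<in> Oa \<longrightarrow> lattice_pt N l \<in> range xh) \<and>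
     (\<forall>k. xh k \<notin> Oc \<longrightarrow> xh k \<in> range (lattice_pt N)) \<and>
     frontier Oc \<subseteq> range xh \<and>
     (\<forall>k. element xh k \<subseteq> Oc \<longrightarrow> xh k - xh (k - 1) \<ge> 2 * eps N)"

definition lattice_index :: "nat \<Rightarrow> (int \<Rightarrow> real) \<Rightarrow> int \<Rightarrow> int" where
  "lattice_index N xh k = (GREATEST l. lattice_pt N l \<le> xh k)"

definition cont_elements :: "nat \<Rightarrow> real set \<Rightarrow> (int \<Rightarrow> real) \<Rightarrow> int set" where
  "cont_elements K Oc xh = {k \<in> {1..int K}. element xh k \<inter> {0..1} \<noteq> {} \<and>
     element xh k \<inter> {1<..} = {} \<and> element xh k \<subseteq> Oc}"

definition nodal_interp :: "(int \<Rightarrow> real) \<Rightarrow> (real \<Rightarrow> real) \<Rightarrow> real \<Rightarrow> real" where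
  "nodal_interp y v x =
     (let k = (THE k. y (k - 1) < x \<and> x \<le> y k)
      in v (y (k - 1)) + (v (y k) - v (y (k - 1))) / (y k - y (k - 1)) * (x - y (k - 1)))"

definition J_U :: "nat \<Rightarrow> (int \<Rightarrow> real) \<Rightarrow> (real \<Rightarrow> real) \<Rightarrow> real \<Rightarrow> real" where
  "J_U K xh v x = nodal_interp xh v x
     - 1 / 2 * (\<Sum>k\<in>{1..int K}. (xh (k + 1) - xh (k - 1)) * v (xh k))"

definition inner_eps :: "nat \<Rightarrow> (real \<Rightarrow> real) \<Rightarrow> (real \<Rightarrow> real) \<Rightarrow> real" where
  "inner_eps N f g = (\<Sum>l\<in>{1..int N}. eps N * f (lattice_pt N l) * g (lattice_pt N l))"

definition inner_h :: "nat \<Rightarrow> (int \<Rightarrow> real) \<Rightarrow> (real \<Rightarrow> real) \<Rightarrow> (real \<Rightarrow> real) \<Rightarrow> real" where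
  "inner_h K xh f g =
     (\<Sum>k\<in>{1..int K}. 1 / 2 * (xh (k + 1) - xh (k - 1)) * f (xh k) * g (xh k))"

section \<open>Common refinement\<close>

text \<open>The numbering of the refined nodes \<open>xr\<close> is fixed only up to a shift.\<close>

definition is_common_refinement :: "nat \<Rightarrow> (int \<Rightarrow> real) \<Rightarrow> (int \<Rightarrow> real) \<Rightarrow> bool" where
  "is_common_refinement N xh xr \<longleftrightarrow> strict_mono xr \<and> range xr = range (lattice_pt N) \<union> range xh"

definition ref_index :: "(int \<Rightarrow> real) \<Rightarrow> (int \<Rightarrow> real) \<Rightarrow> int \<Rightarrow> int" where
  "ref_index xh xr k = (THE j. xr j = xh k)"

definition ref_count :: "nat \<Rightarrow> nat \<Rightarrow> (int \<Rightarrow> real) \<Rightarrow> nat" where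
  "ref_count N K xh = card (lattice_pt N ` {1..int N} \<union> xh ` {1..int K})"

definition ref_size :: "(int \<Rightarrow> real) \<Rightarrow> int \<Rightarrow> real" where
  "ref_size xr j = xr j - xr (j - 1)"

definition ref_avg :: "(int \<Rightarrow> real) \<Rightarrow> int \<Rightarrow> real" where
  "ref_avg xr j = 1 / 2 * (ref_size xr j + ref_size xr (j + 1))"

definition ref_diff :: "(int \<Rightarrow> real) \<Rightarrow> (real \<Rightarrow> real) \<Rightarrow> int \<Rightarrow> real" where
  "ref_diff xr f j = (f (xr j) - f (xr (j - 1))) / ref_size xr j"

definition ref_diff2 :: "(int \<Rightarrow> real) \<Rightarrow> (real \<Rightarrow> real) \<Rightarrow> int \<Rightarrow> real" where
  "ref_diff2 xr f j = (ref_diff xr f (j + 1) - ref_diff xr f j) / ref_avg xr j"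

definition D1 :: "(int \<Rightarrow> real) \<Rightarrow> (int \<Rightarrow> real) \<Rightarrow> int \<Rightarrow> int set" where
  "D1 xh xr k = {ref_index xh xr (k - 1) + 1..ref_index xh xr k}"

definition D2 :: "(int \<Rightarrow> real) \<Rightarrow> (int \<Rightarrow> real) \<Rightarrow> int \<Rightarrow> int set" where
  "D2 xh xr k = {ref_index xh xr (k - 1) + 1..ref_index xh xr k - 1}"

definition h_tilde :: "nat \<Rightarrow> (int \<Rightarrow> real) \<Rightarrow> (int \<Rightarrow> real) \<Rightarrow> int \<Rightarrow> real" where
  "h_tilde N xh xr k = 1 / 2 * of_int (ref_index xh xr k - ref_index xh xr (k - 1)) * eps N"

definition h_hat :: "nat \<Rightarrow> (int \<Rightarrow> real) \<Rightarrow> (int \<Rightarrow> real) \<Rightarrow> int \<Rightarrow> real" where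
  "h_hat N xh xr k =
     (let m = of_int (ref_index xh xr k - ref_index xh xr (k - 1))
      in sqrt (m * eps N * ((m + 1) * eps N)\<^sup>2 / (xh k - xh (k - 1))))"

section \<open>Error estimator for the external forces\<close>

definition eta_ext ::
  "nat \<Rightarrow> nat \<Rightarrow> (int \<Rightarrow> real) \<Rightarrow> (int \<Rightarrow> real) \<Rightarrow> (real \<Rightarrow> real) \<Rightarrow> int \<Rightarrow> real" where
  "eta_ext N K xh xr f k = sqrt (
     1 / 128 * (eps N ^ 3 * (lattice_diff N f (lattice_index N xh (k - 1) + 1))\<^sup>2
              + eps N ^ 3 * (lattice_diff N f (lattice_index N xh k + 1))\<^sup>2)\<^sup>2
     + (h_tilde N xh xr k)\<^sup>2 * (\<Sum>j\<in>D2 xh xr k. ref_avg xr j * \<bar>f (xr j)\<bar>\<^sup>2)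
     + 1 / 64 * (real (ref_count N K xh) * eps N) ^ 4 * h_hat N xh xr k ^ 4
         * (\<Sum>j\<in>D2 xh xr k. ref_avg xr j * \<bar>ref_diff2 xr f j\<bar>\<^sup>2)
     + h_hat N xh xr k ^ 4 * (\<Sum>j\<in>D1 xh xr k. ref_size xr j * \<bar>ref_diff xr f j\<bar>\<^sup>2))"

definition E_ext ::
  "nat \<Rightarrow> nat \<Rightarrow> real set \<Rightarrow> (int \<Rightarrow> real) \<Rightarrow> (int \<Rightarrow> real) \<Rightarrow> (real \<Rightarrow> real) \<Rightarrow> real" where
  "E_ext N K Oc xh xr f = sqrt (\<Sum>k\<in>cont_elements K Oc xh. (eta_ext N K xh xr f k)\<^sup>2)"

end

theory Submission
  imports Defs
begin

text \<open>Let \<open>V\<close> be the mean value of \<open>I\<^sub>h v\<close> and \<open>w = v - V\<close>. Since \<open>f\<close> has mean zero, the error is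
  \<open>\<langle>f, w\<rangle>\<^sub>h - \<langle>f, w\<rangle>\<^sub>\<epsilon>\<close>, a difference of two trapezoidal sums of \<open>f w\<close>. It splits into contributions of
  the single mesh elements; those outside the continuum region vanish once the quadrature error of
  a lattice cell cut by a mesh node is charged entirely to the continuum part of that cell.

  On an element of the continuum region, summation by parts against the parabola
  \<open>G = (x - x\<^sub>p) (x\<^sub>q - x) / 2\<close>, which vanishes at both ends, turns the contribution into sums of
  \<open>G f'' w\<close>, of \<open>f' w'\<close> with coefficients at most \<open>h\<^sup>2 / 8\<close>, and of \<open>d f w'\<close> with \<open>d\<close> the distance to the
  midpoint. In the last one \<open>f\<close> is replaced by its smallest interior nodal value at the
  price of a further \<open>f'\<close> term. With \<open>\<bar>w\<bar> \<le> 1/2\<close> the constants add up to less than one.\<close>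

section \<open>Sums over integer intervals\<close>

lemma sum_int_last:
  fixes g :: "int \<Rightarrow> 'a::comm_monoid_add"
  assumes "p < q"
  shows "(\<Sum>j\<in>{p+1..q}. g j) = (\<Sum>j\<in>{p+1..q-1}. g j) + g q"
proof -
  have "{p+1..q} = insert q {p+1..q-1}" using assms by auto
  then show ?thesis by (simp add: add.commute)
qed

lemma sum_telescope_int:
  fixes g :: "int \<Rightarrow> 'a::ab_group_add"
  assumes "p \<le> q"
  shows "(\<Sum>j\<in>{p+1..q}. g j - g (j - 1)) = g q - g p"
  using assms
proof (induction q rule: int_ge_induct)
  case (step q)
  then show ?case by (subst sum_int_last) auto
qed simp

lemma sum_blocks_int:
  fixes J :: "int \<Rightarrow> int" and g :: "int \<Rightarrow> 'a::comm_monoid_add"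
  assumes "mono J"
  shows "(\<Sum>k\<in>{1..int K}. \<Sum>j\<in>{J (k - 1) + 1..J k}. g j) = (\<Sum>j\<in>{J 0 + 1..J (int K)}. g j)"
proof (induction K)
  case (Suc K)
  have *: "{1..int (Suc K)} = insert (int (Suc K)) {1..int K}" by auto
  have "J 0 \<le> J (int K)" "J (int K) \<le> J (int (Suc K))" using assms by (auto intro: monoD)
  then have "{J 0 + 1..J (int (Suc K))} = {J 0 + 1..J (int K)} \<union> {J (int K) + 1..J (int (Suc K))}"
    by auto
  then show ?case unfolding * using Suc
    by (subst sum.insert) (auto simp: sum.union_disjoint add.commute)
qed simp

lemma sum_shift_periodic_int:
  fixes g :: "int \<Rightarrow> 'a::ab_group_add"
  assumes "\<And>k. g (k + int K) = g k"
  shows "(\<Sum>k\<in>{1..int K}. g (k - 1)) = (\<Sum>k\<in>{1..int K}. g k)"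
proof -
  have "(\<Sum>k\<in>{0+1..int K}. g k - g (k - 1)) = g (int K) - g 0"
    by (rule sum_telescope_int) simp
  then show ?thesis using assms[of 0] by (simp add: sum_subtractf)
qed

text \<open>The terms with \<open>G p\<close> and \<open>G q\<close> drop out, so shifting the
  second sum by one index lets both run over the interior nodes. Read from right to left, it returns
  a nodal sum to the cells.\<close>

lemma sum_by_parts_int:
  fixes G a b :: "int \<Rightarrow> real"
  assumes "p < q" "G p = 0" "G q = 0"
  shows "(\<Sum>j\<in>{p+1..q}. G j * a j + G (j - 1) * b j) = (\<Sum>i\<in>{p+1..q-1}. G i * (a i + b (i + 1)))"
proof -
  have "(\<Sum>j\<in>{p+1..q}. G (j - 1) * b j) = (\<Sum>i\<in>{p+1-1..q-1}. G i * b (i + 1))"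
    by (rule sum.reindex_bij_witness[of _ "\<lambda>i. i + 1" "\<lambda>j. j - 1"]) auto
  also have "{p+1-1..q-1} = insert p {p+1..q-1}" using assms by auto
  finally show ?thesis using assms
    by (simp add: sum.distrib distrib_left sum_int_last)
qed

lemma weighted_Cauchy_Schwarz_sum:
  fixes a b w :: "'a \<Rightarrow> real"
  assumes "\<And>i. i \<in> A \<Longrightarrow> w i > 0"
  shows "(\<Sum>i\<in>A. a i * b i)\<^sup>2 \<le> (\<Sum>i\<in>A. w i * (a i)\<^sup>2) * (\<Sum>i\<in>A. (b i)\<^sup>2 / w i)"
proof -
  have "(\<Sum>i\<in>A. (sqrt (w i) * a i) * (b i / sqrt (w i)))\<^sup>2
      \<le> (\<Sum>i\<in>A. (sqrt (w i) * a i)\<^sup>2) * (\<Sum>i\<in>A. (b i / sqrt (w i))\<^sup>2)"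
    by (rule Cauchy_Schwarz_ineq_sum)
  moreover have "(\<Sum>i\<in>A. (sqrt (w i) * a i) * (b i / sqrt (w i))) = (\<Sum>i\<in>A. a i * b i)"
    using assms by (intro sum.cong) (auto, metis less_irrefl)
  moreover have "(\<Sum>i\<in>A. (sqrt (w i) * a i)\<^sup>2) = (\<Sum>i\<in>A. w i * (a i)\<^sup>2)"
    using assms by (intro sum.cong) (auto simp: power_mult_distrib less_imp_le)
  moreover have "(\<Sum>i\<in>A. (b i / sqrt (w i))\<^sup>2) = (\<Sum>i\<in>A. (b i)\<^sup>2 / w i)"
    using assms by (intro sum.cong) (auto simp: power_divide less_imp_le)
  ultimately show ?thesis by simp
qed

text \<open>Cauchy-Schwarz in the plane in root-free form: \<open>x * w\<close> and
  \<open>y * u\<close> have the same product as the bounds for the two squares, so AM-GM controls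
  the mixed term. It adds estimates whose two factors both differ.\<close>

lemma square_add_le:
  fixes a b x y u w :: real
  assumes "a\<^sup>2 \<le> x * u" "b\<^sup>2 \<le> y * w" "0 \<le> x" "0 \<le> y" "0 \<le> u" "0 \<le> w"
  shows "(a + b)\<^sup>2 \<le> (x + y) * (u + w)"
proof -
  have "(2 * (a * b))\<^sup>2 = 4 * (a\<^sup>2 * b\<^sup>2)" by (simp add: power2_eq_square)
  also have "\<dots> \<le> 4 * ((x * u) * (y * w))" using assms by (intro mult_left_mono mult_mono) auto
  also have "\<dots> = (x * w + y * u)\<^sup>2 - (x * w - y * u)\<^sup>2" by (simp add: power2_eq_square algebra_simps)
  also have "\<dots> \<le> (x * w + y * u)\<^sup>2" by simp
  finally have "2 * (a * b) \<le> x * w + y * u"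
    by (rule power2_le_imp_le) (use assms in auto)
  then show ?thesis using assms by (simp add: power2_sum algebra_simps)
qed

text \<open>Summation by parts with the distance to the midpoint of the whole interval: on each cell
  the two summands add up to an increment of \<open>(x j - (x p + x q) / 2) * g j\<close>, whose end
  values form the coarse trapezoid.\<close>

lemma trapezoid_defect:
  fixes x g :: "int \<Rightarrow> real"
  assumes "p \<le> q"
  shows "(x q - x p) * (g p + g q) / 2 - (\<Sum>j\<in>{p+1..q}. (x j - x (j - 1)) * (g (j - 1) + g j) / 2)
    = (\<Sum>j\<in>{p+1..q}. ((x (j - 1) + x j) / 2 - (x p + x q) / 2) * (g j - g (j - 1)))"
proof -
  let ?T = "\<lambda>j. (x j - (x p + x q) / 2) * g j"
  have "(\<Sum>j\<in>{p+1..q}. (x j - x (j - 1)) * (g (j - 1) + g j) / 2)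
      + (\<Sum>j\<in>{p+1..q}. ((x (j - 1) + x j) / 2 - (x p + x q) / 2) * (g j - g (j - 1)))
      = (\<Sum>j\<in>{p+1..q}. ?T j - ?T (j - 1))"
    unfolding sum.distrib[symmetric] by (intro sum.cong) (auto simp: field_simps)
  also have "\<dots> = ?T q - ?T p" by (rule sum_telescope_int[OF assms])
  finally show ?thesis by (simp add: field_simps)
qed

text \<open>Both sides compare the second moment of the interval about its midpoint, h^3/12, with
  the midpoint rule on the cells: a cell of length s and midpoint distance d has second moment s d^2
  + s^3/12.\<close>

lemma sum_mid_squares:
  fixes x :: "int \<Rightarrow> real"
  assumes "p \<le> q"
  shows "12 * (\<Sum>j\<in>{p+1..q}. (x j - x (j - 1)) * ((x (j - 1) + x j) / 2 - (x p + x q) / 2)\<^sup>2)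
    = (x q - x p) ^ 3 - (\<Sum>j\<in>{p+1..q}. (x j - x (j - 1)) ^ 3)"
proof -
  let ?t = "\<lambda>j. x j - (x p + x q) / 2"
  have "12 * (\<Sum>j\<in>{p+1..q}. (x j - x (j - 1)) * ((x (j - 1) + x j) / 2 - (x p + x q) / 2)\<^sup>2)
      + (\<Sum>j\<in>{p+1..q}. (x j - x (j - 1)) ^ 3) = (\<Sum>j\<in>{p+1..q}. 4 * ?t j ^ 3 - 4 * ?t (j - 1) ^ 3)"
    unfolding sum_distrib_left sum.distrib[symmetric]
  proof (rule sum.cong[OF refl])
    fix j
    have *: "12 * ((s - t) * ((s + t) / 2)\<^sup>2) + (s - t) ^ 3 = 4 * s ^ 3 - 4 * t ^ 3" for s t :: real
      by (simp add: power2_eq_square power3_eq_cube field_simps)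
    have 1: "x j - x (j - 1) = ?t j - ?t (j - 1)" by simp
    have 2: "(x (j - 1) + x j) / 2 - (x p + x q) / 2 = (?t j + ?t (j - 1)) / 2" by (simp add: field_simps)
    show "12 * ((x j - x (j - 1)) * ((x (j - 1) + x j) / 2 - (x p + x q) / 2)\<^sup>2) + (x j - x (j - 1)) ^ 3
      = 4 * ?t j ^ 3 - 4 * ?t (j - 1) ^ 3"
      unfolding 1 2 by (rule *)
  qed
  also have "\<dots> = 4 * ?t q ^ 3 - 4 * ?t p ^ 3" by (rule sum_telescope_int[OF assms])
  also have "\<dots> = (x q - x p) ^ 3" by (simp add: power3_eq_cube field_simps)
  finally show ?thesis by simp
qed

text \<open>The discrete product rule splits the increment of f v. In the part with the increment of
  f, distance to the midpoint times cell length is the negative increment of the parabola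
  \<open>G\<close>, so a second summation by parts yields the second difference of f.\<close>

lemma trapezoid_defect_product:
  fixes x f v :: "int \<Rightarrow> real"
  assumes "p < q" and pos: "\<And>j. j \<in> {p+1..q} \<Longrightarrow> x (j - 1) < x j"
  defines "D \<equiv> \<lambda>j. (f j - f (j - 1)) / (x j - x (j - 1))"
  defines "G \<equiv> \<lambda>j. (x j - x p) * (x q - x j) / 2"
  shows "(x q - x p) * (f p * v p + f q * v q) / 2
      - (\<Sum>j\<in>{p+1..q}. (x j - x (j - 1)) * (f (j - 1) * v (j - 1) + f j * v j) / 2)
    = (\<Sum>j\<in>{p+1..q}. ((x (j - 1) + x j) / 2 - (x p + x q) / 2) * ((f (j - 1) + f j) / 2) * (v j - v (j - 1)))
    + (\<Sum>i\<in>{p+1..q-1}. G i * (D (i + 1) - D i) * v i)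
    + (\<Sum>j\<in>{p+1..q}. (G (j - 1) + G j) / 2 * D j * (v j - v (j - 1)))"
proof -
  let ?d = "\<lambda>j. (x (j - 1) + x j) / 2 - (x p + x q) / 2"
  let ?w = "\<lambda>j. D j * ((v (j - 1) + v j) / 2)"
  let ?y = "\<lambda>j. D j * (v j - v (j - 1)) / 2"
  have G0: "G p = 0" "G q = 0" by (auto simp: G_def)
  have "(\<Sum>j\<in>{p+1..q}. ?d j * (f j * v j - f (j - 1) * v (j - 1)))
      = (\<Sum>j\<in>{p+1..q}. ?d j * ((f (j - 1) + f j) / 2) * (v j - v (j - 1)) + (G j * (- ?w j) + G (j - 1) * ?w j))"
  proof (rule sum.cong[OF refl])
    fix j assume "j \<in> {p+1..q}"
    then have "f j - f (j - 1) = D j * (x j - x (j - 1))" using pos[of j] by (simp add: D_def)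
    then have f: "f j = f (j - 1) + D j * (x j - x (j - 1))" by simp
    have "?d j * (f j * v j - f (j - 1) * v (j - 1)) - ?d j * ((f (j - 1) + f j) / 2) * (v j - v (j - 1))
      = ?d j * (f j - f (j - 1)) * ((v (j - 1) + v j) / 2)" by (simp add: field_simps)
    also have "\<dots> = (?d j * (x j - x (j - 1))) * ?w j" using f by simp
    also have "?d j * (x j - x (j - 1)) = G (j - 1) - G j" by (simp add: G_def field_simps)
    finally have "?d j * (f j * v j - f (j - 1) * v (j - 1)) - ?d j * ((f (j - 1) + f j) / 2) * (v j - v (j - 1))
      = G j * (- ?w j) + G (j - 1) * ?w j" by (simp only: left_diff_distrib mult_minus_right)
    then show "?d j * (f j * v j - f (j - 1) * v (j - 1))
      = ?d j * ((f (j - 1) + f j) / 2) * (v j - v (j - 1)) + (G j * (- ?w j) + G (j - 1) * ?w j)"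
      by linarith
  qed
  also have "\<dots> = (\<Sum>j\<in>{p+1..q}. ?d j * ((f (j - 1) + f j) / 2) * (v j - v (j - 1)))
      + (\<Sum>i\<in>{p+1..q-1}. G i * (- ?w i + ?w (i + 1)))"
    using sum_by_parts_int[of p q G "\<lambda>j. - ?w j" ?w] assms(1) G0 by (simp add: sum.distrib)
  \<comment> \<open>The cell means of v on both sides of node \<open>i\<close> are replaced by the
    nodal value \<open>v i\<close>; the corrections are the half increments
    \<open>?y\<close>.\<close>
  also have "(\<Sum>i\<in>{p+1..q-1}. G i * (- ?w i + ?w (i + 1)))
      = (\<Sum>i\<in>{p+1..q-1}. G i * (D (i + 1) - D i) * v i) + (\<Sum>i\<in>{p+1..q-1}. G i * (?y i + ?y (i + 1)))"
    unfolding sum.distrib[symmetric] by (rule sum.cong) (auto simp: field_simps)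
  also have "(\<Sum>i\<in>{p+1..q-1}. G i * (?y i + ?y (i + 1))) = (\<Sum>j\<in>{p+1..q}. G j * ?y j + G (j - 1) * ?y j)"
    using sum_by_parts_int[of p q G ?y ?y] assms(1) G0 by simp
  also have "\<dots> = (\<Sum>j\<in>{p+1..q}. (G (j - 1) + G j) / 2 * D j * (v j - v (j - 1)))"
    by (rule sum.cong) (auto simp: field_simps)
  finally show ?thesis
    using trapezoid_defect[of p q x "\<lambda>j. f j * v j"] assms(1) by simp
qed

section \<open>Estimate on a single element\<close>

text \<open>The load \<open>e j\<close> is the coefficient of the quadrature error charged to the cell \<open>j\<close>; it carries the
  opposite sign of the coefficient of \<open>f' w'\<close> coming from \<open>G\<close>, hence the bound \<open>h\<^sup>2 / 8\<close> survives.\<close>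

lemma refined_element_estimate:
  fixes x f v e :: "int \<Rightarrow> real" and p q :: int and \<tau> c :: real
  assumes pq: "p + 2 \<le> q"
    and pos: "\<And>j. j \<in> {p+1..q} \<Longrightarrow> x (j - 1) < x j"
    and le: "\<And>j. j \<in> {p+1..q} \<Longrightarrow> x j - x (j - 1) \<le> \<tau>"
    and v: "\<And>i. i \<in> {p+1..q-1} \<Longrightarrow> \<bar>v i\<bar> \<le> 1/2"
    and e: "\<And>j. j \<in> {p+1..q} \<Longrightarrow> 0 \<le> e j \<and> e j \<le> \<tau>\<^sup>2 / 2"
  defines "h \<equiv> x q - x p"
  assumes h2: "2 * \<tau> \<le> h"
    and c: "h ^ 4 \<le> c"
  defines "s \<equiv> \<lambda>j. x j - x (j - 1)"
  defines "a \<equiv> \<lambda>j. (s j + s (j + 1)) / 2"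
  defines "D \<equiv> \<lambda>j. (f j - f (j - 1)) / s j"
  shows "(h * (f p * v p + f q * v q) / 2 - (\<Sum>j\<in>{p+1..q}. s j * (f (j - 1) * v (j - 1) + f j * v j) / 2)
      - (\<Sum>j\<in>{p+1..q}. e j * D j * (v j - v (j - 1))))\<^sup>2
    \<le> (3 / 4 * (\<Sum>j\<in>{p+1..q}. (v j - v (j - 1))\<^sup>2 / s j) + 1 / 4 * h)
      * ((of_int (q - p) * \<tau> / 2)\<^sup>2 * (\<Sum>i\<in>{p+1..q-1}. a i * (f i)\<^sup>2)
         + c / 64 * (\<Sum>i\<in>{p+1..q-1}. a i * ((D (i + 1) - D i) / a i)\<^sup>2)
         + c * (\<Sum>j\<in>{p+1..q}. s j * (D j)\<^sup>2))"
proof -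
  let ?I = "{p+1..q}" and ?J = "{p+1..q-1}"
  define V where "V = (\<Sum>j\<in>?I. (v j - v (j - 1))\<^sup>2 / s j)"
  define A1 where "A1 = (\<Sum>i\<in>?J. a i * (f i)\<^sup>2)"
  define A2 where "A2 = (\<Sum>i\<in>?J. a i * ((D (i + 1) - D i) / a i)\<^sup>2)"
  define A3 where "A3 = (\<Sum>j\<in>?I. s j * (D j)\<^sup>2)"
  define m where "m = (of_int (q - p) :: real)"
  define d where "d = (\<lambda>j. (x (j - 1) + x j) / 2 - (x p + x q) / 2)"
  define G where "G = (\<lambda>j. (x j - x p) * (x q - x j) / 2)"
  define S where "S = (\<Sum>j\<in>?I. s j * (d j)\<^sup>2)"

  \<comment> \<open>Cell lengths, signs and the second moment of the cell midpoints\<close>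
  have spos: "0 < s j" "s j \<le> \<tau>" if "j \<in> ?I" for j
    using pos[OF that] le[OF that] by (auto simp: s_def)
  have \<tau>: "0 < \<tau>" using spos[of q] pq by auto
  have apos: "0 < a i" if "i \<in> ?J" for i
    using spos(1)[of i] spos(1)[of "i + 1"] that by (auto simp: a_def)
  have sum_s: "(\<Sum>j\<in>?I. s j) = h"
    unfolding s_def h_def by (rule sum_telescope_int) (use pq in auto)
  have mono: "x i \<le> x j" if "p \<le> i" "i \<le> j" "j \<le> q" for i j
  proof -
    have "x j - x i = (\<Sum>l\<in>{i+1..j}. x l - x (l - 1))"
      by (rule sum_telescope_int[symmetric]) (use that in auto)
    also have "\<dots> \<ge> 0" by (rule sum_nonneg) (use that pos in \<open>force simp: less_imp_le\<close>)
    finally show ?thesis by simp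
  qed
  have hm: "h \<le> m * \<tau>"
  proof -
    have "h \<le> (\<Sum>j\<in>?I. \<tau>)" unfolding sum_s[symmetric] by (rule sum_mono) (use spos in auto)
    then show ?thesis using pq by (simp add: m_def)
  qed
  have h: "0 < h" using \<tau> h2 by linarith
  have V0: "0 \<le> V" unfolding V_def by (rule sum_nonneg) (use spos in \<open>auto simp: less_imp_le\<close>)
  have A10: "0 \<le> A1" unfolding A1_def by (rule sum_nonneg) (use apos in \<open>auto simp: less_imp_le\<close>)
  have A20: "0 \<le> A2" unfolding A2_def by (rule sum_nonneg) (use apos in \<open>auto simp: less_imp_le\<close>)
  have A30: "0 \<le> A3" unfolding A3_def by (rule sum_nonneg) (use spos in \<open>auto simp: less_imp_le\<close>)
  have S0: "0 \<le> S" unfolding S_def by (rule sum_nonneg) (use spos in \<open>auto simp: less_imp_le\<close>)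
  have CS: "(\<Sum>j\<in>?I. b j * (v j - v (j - 1)))\<^sup>2 \<le> (\<Sum>j\<in>?I. s j * (b j)\<^sup>2) * V" for b
    unfolding V_def by (rule weighted_Cauchy_Schwarz_sum) (use spos in auto)
  have S12: "12 * S = h ^ 3 - (\<Sum>j\<in>?I. (s j) ^ 3)"
    unfolding S_def d_def s_def h_def by (rule sum_mid_squares) (use pq in auto)
  have sum_a: "(\<Sum>i\<in>?J. a i) = h - (s (p + 1) + s q) / 2"
  proof -
    have "2 * (\<Sum>i\<in>?J. a i) = (\<Sum>i\<in>?J. (x i + x (i + 1)) - (x (i - 1) + x (i - 1 + 1)))"
      unfolding sum_distrib_left by (rule sum.cong) (auto simp: a_def s_def)
    also have "\<dots> = (x (q - 1) + x (q - 1 + 1)) - (x p + x (p + 1))"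
      by (rule sum_telescope_int) (use pq in auto)
    finally show ?thesis by (simp add: h_def s_def field_simps)
  qed
  \<comment> \<open>The bound is by the total weight of the interior nodes, the only ones seen by
    \<open>A1\<close>. The factor 1/8 is 1/2 times (1/2)^2: the second goes into
    \<open>h_tilde\<close>, the first is the share of \<open>V\<close> left for
    \<open>T1\<close>.\<close>
  have S_le: "S \<le> (m * \<tau>)\<^sup>2 / 8 * (\<Sum>i\<in>?J. a i)"
  proof (cases "q = p + 2")
    case True
    \<comment> \<open>Two cells of length at most \<tau> with total length at least 2 \<tau> have
      length exactly \<tau>, and the bound is then attained.\<close>
    have I: "?I = {p+1, q}" using True by auto
    have "s (p + 1) + s q = h" using sum_s True unfolding I by simp
    moreover have "s (p + 1) \<le> \<tau>" "s q \<le> \<tau>" using spos pq by auto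
    ultimately have "s (p + 1) = \<tau>" "s q = \<tau>" "h = 2 * \<tau>" using h2 by linarith+
    then show ?thesis using S12 True unfolding sum_a I by (simp add: m_def power2_eq_square power3_eq_cube)
  next
    case False
    then have m3: "3 \<le> m" using pq by (simp add: m_def)
    \<comment> \<open>With three or more cells there is room to drop the cubes of the cell lengths.
      The interior weight is at least h - \<tau>, so a cubic inequality in h remains.\<close>
    have "0 \<le> (\<Sum>j\<in>?I. (s j) ^ 3)" by (rule sum_nonneg) (use spos in \<open>auto simp: less_imp_le\<close>)
    then have "12 * S \<le> h ^ 3" using S12 by linarith
    also have "h ^ 3 \<le> 3 / 2 * (m * \<tau>)\<^sup>2 * (h - \<tau>)"
    proof (cases "3 * \<tau> \<le> h")
      case True
      have "h ^ 3 = h\<^sup>2 * h" by (simp add: power2_eq_square power3_eq_cube)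
      also have "\<dots> \<le> (m * \<tau>)\<^sup>2 * (3 / 2 * (h - \<tau>))"
        using True hm h by (intro mult_mono power_mono) auto
      finally show ?thesis by (simp only: mult_ac)
    next
      case False
      \<comment> \<open>On [2 \<tau>, 3 \<tau>] the convex function h^3 lies below its chord
        \<open>19 * \<tau>^2 * h - 30 * \<tau>^3\<close>; the factor h + 5 \<tau> is the one that
        cancels the quadratic term. The remaining inequality is linear, with equality at h = 3
        \<tau>.\<close>
      have "0 \<le> (h - 2 * \<tau>) * (3 * \<tau> - h) * (h + 5 * \<tau>)"
        using False h2 h \<tau> by (intro mult_nonneg_nonneg) auto
      then have "h ^ 3 \<le> 19 * \<tau>\<^sup>2 * h - 30 * \<tau> ^ 3"
        by (simp add: power2_eq_square power3_eq_cube algebra_simps)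
      also have "\<dots> \<le> 3 / 2 * (3 * \<tau>)\<^sup>2 * (h - \<tau>)"
      proof -
        have "0 \<le> \<tau>\<^sup>2 * (11 / 2 * (3 * \<tau> - h))" using False by (intro mult_nonneg_nonneg) auto
        then show ?thesis by (simp add: power2_eq_square power3_eq_cube algebra_simps)
      qed
      also have "\<dots> \<le> 3 / 2 * (m * \<tau>)\<^sup>2 * (h - \<tau>)"
        using m3 \<tau> h2 by (intro mult_right_mono mult_left_mono power_mono mult_mono) auto
      finally show ?thesis .
    qed
    also have "\<dots> \<le> 3 / 2 * (m * \<tau>)\<^sup>2 * (\<Sum>i\<in>?J. a i)"
      unfolding sum_a using spos(2)[of "p + 1"] spos(2)[of q] pq by (intro mult_left_mono) auto
    finally show ?thesis by simp
  qed
  \<comment> \<open>Minimality over the interior nodes gives \<open>(f r)^2\<close> times the total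
    interior weight at most \<open>A1\<close>.\<close>
  obtain r where r: "r \<in> ?J" and rmin: "\<And>i. i \<in> ?J \<Longrightarrow> (f r)\<^sup>2 \<le> (f i)\<^sup>2"
  proof -
    have "finite ?J" "?J \<noteq> {}" using pq by auto
    then show ?thesis
      by (intro that[of "arg_min_on (\<lambda>i. (f i)\<^sup>2) ?J"] arg_min_if_finite(1) arg_min_least) auto
  qed

  \<comment> \<open>The four partial sums of the defect and their bounds\<close>
  define T1 where "T1 = (\<Sum>j\<in>?I. (f r * d j) * (v j - v (j - 1)))"
  define T2 where "T2 = (\<Sum>j\<in>?I. (d j * ((f (j - 1) + f j) / 2 - f r)) * (v j - v (j - 1)))"
  define T3 where "T3 = (\<Sum>i\<in>?J. G i * (D (i + 1) - D i) * v i)"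
  define T4 where "T4 = (\<Sum>j\<in>?I. ((G (j - 1) + G j) / 2 - e j) * D j * (v j - v (j - 1)))"
  have T1: "T1\<^sup>2 \<le> (V / 2) * ((m * \<tau> / 2)\<^sup>2 * A1)"
  proof -
    have "T1\<^sup>2 \<le> (\<Sum>j\<in>?I. s j * (f r * d j)\<^sup>2) * V" unfolding T1_def by (rule CS)
    also have "(\<Sum>j\<in>?I. s j * (f r * d j)\<^sup>2) = (f r)\<^sup>2 * S"
      by (simp add: S_def sum_distrib_left power_mult_distrib mult_ac)
    also have "\<dots> \<le> (f r)\<^sup>2 * ((m * \<tau>)\<^sup>2 / 8 * (\<Sum>i\<in>?J. a i))"
      using S_le by (intro mult_left_mono) auto
    also have "\<dots> = (m * \<tau>)\<^sup>2 / 8 * (\<Sum>i\<in>?J. a i * (f r)\<^sup>2)"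
      by (simp add: sum_distrib_right sum_distrib_left mult_ac)
    also have "\<dots> \<le> (m * \<tau>)\<^sup>2 / 8 * A1" unfolding A1_def
      using rmin apos by (intro mult_left_mono sum_mono) (auto simp: less_imp_le)
    finally show ?thesis using V0 by (simp add: power_divide mult_right_mono mult_ac)
  qed
  \<comment> \<open>Every nodal value differs from \<open>f r\<close> by at most the total variation
    \<open>R\<close> over the element, and Cauchy-Schwarz bounds \<open>R^2\<close> by h times the
    squared norm \<open>A3\<close> of the discrete derivative.\<close>
  have osc: "\<bar>(f (j - 1) + f j) / 2 - f r\<bar>\<^sup>2 \<le> h * A3" if j: "j \<in> ?I" for j
  proof -
    define R where "R = (\<Sum>l\<in>?I. \<bar>f l - f (l - 1)\<bar>)"
    have half: "\<bar>f l - f i\<bar> \<le> R" if "p \<le> i" "i \<le> l" "l \<le> q" for i l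
    proof -
      have "f l - f i = (\<Sum>n\<in>{i+1..l}. f n - f (n - 1))"
        by (rule sum_telescope_int[symmetric]) (use that in auto)
      also have "\<bar>\<dots>\<bar> \<le> (\<Sum>n\<in>{i+1..l}. \<bar>f n - f (n - 1)\<bar>)" by (rule sum_abs)
      also have "\<dots> \<le> R" unfolding R_def by (rule sum_mono2) (use that in auto)
      finally show ?thesis .
    qed
    have full: "\<bar>f l - f r\<bar> \<le> R" if "p \<le> l" "l \<le> q" for l
      using half[of r l] half[of l r] that r by (cases "r \<le> l") (auto simp: abs_minus_commute)
    have "(f (j - 1) + f j) / 2 - f r = ((f (j - 1) - f r) + (f j - f r)) / 2" by (simp add: field_simps)
    also have "\<bar>\<dots>\<bar> \<le> R" using full[of "j - 1"] full[of j] j by auto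
    finally have "\<bar>(f (j - 1) + f j) / 2 - f r\<bar>\<^sup>2 \<le> R\<^sup>2" by (rule power_mono) simp
    also have "R = (\<Sum>l\<in>?I. 1 * \<bar>f l - f (l - 1)\<bar>)" by (simp add: R_def)
    also have "\<dots>\<^sup>2 \<le> (\<Sum>l\<in>?I. s l * 1\<^sup>2) * (\<Sum>l\<in>?I. \<bar>f l - f (l - 1)\<bar>\<^sup>2 / s l)"
      by (rule weighted_Cauchy_Schwarz_sum) (use spos in auto)
    also have "(\<Sum>l\<in>?I. \<bar>f l - f (l - 1)\<bar>\<^sup>2 / s l) = A3"
      unfolding A3_def by (rule sum.cong) (use spos(1) in \<open>force simp: D_def power2_eq_square\<close>)+
    finally show ?thesis using sum_s by simp
  qed
  have T2: "T2\<^sup>2 \<le> (V / 12) * (h ^ 4 * A3)"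
  proof -
    have "T2\<^sup>2 \<le> (\<Sum>j\<in>?I. s j * (d j * ((f (j - 1) + f j) / 2 - f r))\<^sup>2) * V" unfolding T2_def by (rule CS)
    also have "\<dots> \<le> (S * (h * A3)) * V"
    proof (rule mult_right_mono[OF _ V0])
      have "(\<Sum>j\<in>?I. s j * (d j * ((f (j - 1) + f j) / 2 - f r))\<^sup>2)
          = (\<Sum>j\<in>?I. s j * (d j)\<^sup>2 * \<bar>(f (j - 1) + f j) / 2 - f r\<bar>\<^sup>2)"
        by (rule sum.cong) (auto simp: power_mult_distrib)
      also have "\<dots> \<le> (\<Sum>j\<in>?I. s j * (d j)\<^sup>2 * (h * A3))"
        using osc spos by (intro sum_mono mult_left_mono) (auto simp: less_imp_le)
      also have "\<dots> = S * (h * A3)" unfolding S_def by (rule sum_distrib_right[symmetric])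
      finally show "(\<Sum>j\<in>?I. s j * (d j * ((f (j - 1) + f j) / 2 - f r))\<^sup>2) \<le> S * (h * A3)" .
    qed
    also have "\<dots> \<le> (h ^ 3 / 12 * (h * A3)) * V"
    proof -
      have "0 \<le> (\<Sum>j\<in>?I. (s j) ^ 3)" by (rule sum_nonneg) (use spos in \<open>auto simp: less_imp_le\<close>)
      then have "S \<le> h ^ 3 / 12" using S12 by linarith
      then show ?thesis using h A30 V0 by (intro mult_right_mono) auto
    qed
    also have "\<dots> = (V / 12) * (h ^ 4 * A3)" by (simp add: power3_eq_cube power4_eq_xxxx)
    finally show ?thesis .
  qed
  have G: "0 \<le> G i" "G i \<le> h\<^sup>2 / 8" if "i \<in> {p..q}" for i
  proof -
    show "0 \<le> G i" using that mono[of p i] mono[of i q] by (auto simp: G_def)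
    have "h\<^sup>2 - 8 * G i = ((x i - x p) - (x q - x i))\<^sup>2"
      by (simp add: G_def h_def power2_eq_square field_simps)
    then show "G i \<le> h\<^sup>2 / 8" using zero_le_power2[of "(x i - x p) - (x q - x i)"] by linarith
  qed
  have T4: "T4\<^sup>2 \<le> (V / 64) * (h ^ 4 * A3)"
  proof -
    have "T4\<^sup>2 \<le> (\<Sum>j\<in>?I. s j * (((G (j - 1) + G j) / 2 - e j) * D j)\<^sup>2) * V" unfolding T4_def by (rule CS)
    also have "\<dots> \<le> (h ^ 4 / 64 * A3) * V"
    proof (rule mult_right_mono[OF _ V0])
      have "s j * (((G (j - 1) + G j) / 2 - e j) * D j)\<^sup>2 \<le> h ^ 4 / 64 * (s j * (D j)\<^sup>2)" if j: "j \<in> ?I" for j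
      proof -
        have bd: "\<bar>(b + b') / 2 - w\<bar> \<le> z"
          if "0 \<le> b" "b \<le> z" "0 \<le> b'" "b' \<le> z" "0 \<le> w" "w \<le> z" for b b' w z :: real
          unfolding abs_le_iff using that by (simp add: field_simps)
        have jj: "j \<in> {p..q}" "j - 1 \<in> {p..q}" using j by auto
        \<comment> \<open>Since 2 \<tau> is at most h, the load lies in [0, h^2/8], the same range
          as the mean of \<open>G\<close>. Two numbers of that range differ by at most its
          length.\<close>
        have "(2 * \<tau>)\<^sup>2 \<le> h\<^sup>2" using h2 \<tau> by (intro power_mono) auto
        then have "e j \<le> h\<^sup>2 / 8" using e[OF j] by (simp add: power_mult_distrib)
        then have "\<bar>(G (j - 1) + G j) / 2 - e j\<bar> \<le> h\<^sup>2 / 8"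
          using bd[OF G[OF jj(2)] G[OF jj(1)] e[OF j, THEN conjunct1]] by blast
        then have "\<bar>(G (j - 1) + G j) / 2 - e j\<bar>\<^sup>2 \<le> (h\<^sup>2 / 8)\<^sup>2" by (rule power_mono) simp
        then have "((G (j - 1) + G j) / 2 - e j)\<^sup>2 \<le> h ^ 4 / 64" by (simp add: power_divide)
        then have "((G (j - 1) + G j) / 2 - e j)\<^sup>2 * (s j * (D j)\<^sup>2) \<le> h ^ 4 / 64 * (s j * (D j)\<^sup>2)"
          using spos[OF j] by (intro mult_right_mono) auto
        then show ?thesis by (simp add: power_mult_distrib mult_ac)
      qed
      then show "(\<Sum>j\<in>?I. s j * (((G (j - 1) + G j) / 2 - e j) * D j)\<^sup>2) \<le> h ^ 4 / 64 * A3"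
        unfolding A3_def sum_distrib_left by (rule sum_mono)
    qed
    finally show ?thesis by (simp add: mult_ac)
  qed
  \<comment> \<open>With the bound 1/2 on v, the coefficient is at most h^2/16, whose square is 1/4
    times h^4/64: the 1/64 belongs to the estimator, and 1/4 with the total weight (at most h) to
    the other factor.\<close>
  have T3: "T3\<^sup>2 \<le> (1 / 4 * h) * (h ^ 4 / 64 * A2)"
  proof -
    have "T3 = (\<Sum>i\<in>?J. (G i * v i) * (D (i + 1) - D i))" unfolding T3_def by (simp add: mult_ac)
    also have "\<dots>\<^sup>2 \<le> (\<Sum>i\<in>?J. a i * (G i * v i)\<^sup>2) * (\<Sum>i\<in>?J. (D (i + 1) - D i)\<^sup>2 / a i)"
      by (rule weighted_Cauchy_Schwarz_sum) (use apos in auto)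
    also have "(\<Sum>i\<in>?J. (D (i + 1) - D i)\<^sup>2 / a i) = A2"
      unfolding A2_def by (rule sum.cong) (use apos in \<open>force simp: power2_eq_square\<close>)+
    also have "(\<Sum>i\<in>?J. a i * (G i * v i)\<^sup>2) \<le> (\<Sum>i\<in>?J. a i * (h\<^sup>2 / 16)\<^sup>2)"
    proof (intro sum_mono mult_left_mono)
      fix i assume i: "i \<in> ?J"
      have "\<bar>G i * v i\<bar> \<le> h\<^sup>2 / 8 * (1 / 2)"
        unfolding abs_mult using G[of i] v[OF i] i by (intro mult_mono) auto
      then have "\<bar>G i * v i\<bar>\<^sup>2 \<le> (h\<^sup>2 / 16)\<^sup>2" by (intro power_mono) auto
      then show "(G i * v i)\<^sup>2 \<le> (h\<^sup>2 / 16)\<^sup>2" by simp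
      show "0 \<le> a i" using apos[OF i] by simp
    qed
    also have "\<dots> = (\<Sum>i\<in>?J. a i) * (h\<^sup>2 / 16)\<^sup>2" by (rule sum_distrib_right[symmetric])
    also have "\<dots> \<le> h * (h\<^sup>2 / 16)\<^sup>2"
      unfolding sum_a using spos(1)[of "p + 1"] spos(1)[of q] pq by (intro mult_right_mono) auto
    finally show ?thesis using A20 by (simp add: power_divide mult_right_mono mult_ac)
  qed

  \<comment> \<open>Adding up the constants\<close>
  have T24: "(T2 + T4)\<^sup>2 \<le> (1 / 4 * V) * (h ^ 4 * A3)"
  proof -
    have "0 \<le> (T2 - T4)\<^sup>2" by simp
    then have "(T2 + T4)\<^sup>2 \<le> 2 * T2\<^sup>2 + 2 * T4\<^sup>2" by (simp add: power2_eq_square algebra_simps)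
    also have "\<dots> \<le> 2 * ((V / 12) * (h ^ 4 * A3)) + 2 * ((V / 64) * (h ^ 4 * A3))" using T2 T4 by linarith
    \<comment> \<open>1/6 + 1/32 = 19/96 stays below 1/4, which with the 1/2 used by
      \<open>T1\<close> makes 3/4 of \<open>V\<close>.\<close>
    also have "\<dots> = (2 / 12 + 2 / 64) * (V * (h ^ 4 * A3))" by (simp add: field_simps)
    also have "\<dots> \<le> 1 / 4 * (V * (h ^ 4 * A3))" using V0 A30 by (intro mult_right_mono) auto
    finally show ?thesis by simp
  qed
  have c0: "0 \<le> c" using c zero_le_power[of h 4] h by linarith
  have T24': "(T2 + T4)\<^sup>2 \<le> (1 / 4 * V) * (c * A3)"
    by (rule order_trans[OF T24]) (use c V0 A30 in \<open>auto intro!: mult_left_mono mult_right_mono\<close>)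
  have T3': "T3\<^sup>2 \<le> (1 / 4 * h) * (c / 64 * A2)"
  proof -
    have "h ^ 4 / 64 * A2 \<le> c / 64 * A2" using c A20 by (intro mult_right_mono) auto
    then show ?thesis
      by (intro order_trans[OF T3] mult_left_mono) (use h in auto)
  qed
  \<comment> \<open>Distinct estimator terms are paired with distinct shares of
    \<open>3 / 4 * V + 1 / 4 * h\<close>. Summed over a period, \<open>V\<close> gives at most 1 for
    normalized v and h gives 1, so the final constant is 1.\<close>
  have "(T1 + (T2 + T4))\<^sup>2 \<le> (V / 2 + 1 / 4 * V) * ((m * \<tau> / 2)\<^sup>2 * A1 + c * A3)"
    by (rule square_add_le[OF T1 T24']) (use V0 A10 A30 c0 in auto)
  from square_add_le[OF this T3']
  have "(T1 + (T2 + T4) + T3)\<^sup>2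
    \<le> (V / 2 + 1 / 4 * V + 1 / 4 * h) * ((m * \<tau> / 2)\<^sup>2 * A1 + c * A3 + c / 64 * A2)"
    using V0 A10 A20 A30 c0 h by auto
  moreover have "h * (f p * v p + f q * v q) / 2 - (\<Sum>j\<in>?I. s j * (f (j - 1) * v (j - 1) + f j * v j) / 2)
      - (\<Sum>j\<in>?I. e j * D j * (v j - v (j - 1))) = T1 + (T2 + T4) + T3"
  proof -
    have "h * (f p * v p + f q * v q) / 2 - (\<Sum>j\<in>?I. s j * (f (j - 1) * v (j - 1) + f j * v j) / 2)
      = (\<Sum>j\<in>?I. d j * ((f (j - 1) + f j) / 2) * (v j - v (j - 1))) + T3
        + (\<Sum>j\<in>?I. (G (j - 1) + G j) / 2 * D j * (v j - v (j - 1)))"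
      unfolding h_def s_def d_def T3_def D_def G_def
      by (rule trapezoid_defect_product) (use pq pos in auto)
    moreover have "T1 + T2 = (\<Sum>j\<in>?I. d j * ((f (j - 1) + f j) / 2) * (v j - v (j - 1)))"
      unfolding T1_def T2_def sum.distrib[symmetric] by (rule sum.cong) (auto simp: algebra_simps)
    moreover have "T4 = (\<Sum>j\<in>?I. (G (j - 1) + G j) / 2 * D j * (v j - v (j - 1)))
        - (\<Sum>j\<in>?I. e j * D j * (v j - v (j - 1)))"
      unfolding T4_def sum_subtractf[symmetric] by (rule sum.cong) (auto simp: algebra_simps)
    ultimately show ?thesis by linarith
  qed
  moreover have "V / 2 + 1 / 4 * V + 1 / 4 * h = 3 / 4 * V + 1 / 4 * h" by simp
  ultimately show ?thesis unfolding V_def A1_def A2_def A3_def m_def by (simp add: add_ac)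
qed

section \<open>Integrals of piecewise affine functions\<close>

lemma has_integral_partition_int:
  fixes g :: "real \<Rightarrow> real" and x :: "int \<Rightarrow> real"
  assumes "mono x" "p \<le> q"
    and "\<And>j. j \<in> {p+1..q} \<Longrightarrow> (g has_integral I j) {x (j - 1)..x j}"
  shows "(g has_integral (\<Sum>j\<in>{p+1..q}. I j)) {x p..x q}"
  using assms(2,3)
proof (induction q rule: int_ge_induct)
  case (step q)
  have "(g has_integral (\<Sum>j\<in>{p+1..q}. I j) + I (q + 1)) {x p..x (q + 1)}"
  proof (rule has_integral_combine)
    show "x p \<le> x q" "x q \<le> x (q + 1)" using step.hyps \<open>mono x\<close> by (auto intro: monoD)
    show "(g has_integral (\<Sum>j\<in>{p+1..q}. I j)) {x p..x q}" using step by auto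
    show "(g has_integral I (q + 1)) {x q..x (q + 1)}" using step.prems[of "q + 1"] step.hyps by simp
  qed
  then show ?case using step.hyps by (subst sum_int_last) auto
qed (auto simp: has_integral_refl)

lemma has_integral_shift_periodic:
  fixes g :: "real \<Rightarrow> real"
  assumes "\<And>x. g (x + 1) = g x" "(g has_integral I) {a..b}"
  shows "(g has_integral I) {a + of_int i..b + of_int i}"
proof -
  have per: "g (x + of_int i) = g x" for x
  proof (induction i arbitrary: x rule: int_induct[where k = 0])
    case (step1 i)
    then show ?case using assms(1)[of "x + of_int i"] by (simp add: algebra_simps)
  next
    case (step2 i)
    then show ?case using assms(1)[of "x + of_int (i - 1)"] by (simp add: algebra_simps)
  qed simp
  have "((\<lambda>x. g (1 *\<^sub>R x + (- of_int i))) has_integral I /\<^sub>R 1 ^ DIM(real))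
      (cbox ((a - (- of_int i)) /\<^sub>R 1) ((b - (- of_int i)) /\<^sub>R 1))"
    by (rule has_integral_affinity') (use assms(2) in auto)
  moreover have "g (1 *\<^sub>R x + (- of_int i)) = g x" for x
    using per[of "x - of_int i"] by simp
  ultimately show ?thesis by simp
qed

text \<open>The window is cut at the integer \<open>\<lfloor>a\<rfloor> + 1\<close>, and the part to
  its right is moved back by one period.\<close>

lemma integral_unit_interval_periodic:
  fixes g :: "real \<Rightarrow> real"
  assumes per: "\<And>x. g (x + 1) = g x" and int: "\<And>a b. g integrable_on {a..b}"
  shows "integral {a..a + 1} g = integral {0..1} g"
proof -
  define i where "i = \<lfloor>a\<rfloor>"
  have shift: "integral {c + of_int n..d + of_int n} g = integral {c..d} g" for c d n
    using has_integral_shift_periodic[OF per integrable_integral[OF int]] by (rule integral_unique)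
  have i: "of_int i \<le> a" "a \<le> of_int i + 1" unfolding i_def by linarith+
  have "integral {a..a + 1} g = integral {a..of_int i + 1} g + integral {of_int i + 1..a + 1} g"
    using i int by (intro Henstock_Kurzweil_Integration.integral_combine[symmetric]) auto
  also have "integral {of_int i + 1..a + 1} g = integral {of_int i..a} g"
    using shift[of "of_int i" 1 a] by simp
  also have "integral {a..of_int i + 1} g + integral {of_int i..a} g = integral {of_int i..of_int i + 1} g"
    using i int Henstock_Kurzweil_Integration.integral_combine[of "of_int i" a "of_int i + 1" g] by simp
  also have "\<dots> = integral {0..1} g" using shift[of 0 i 1] by (simp add: add.commute)
  finally show ?thesis .
qed

text \<open>Cauchy-Schwarz against the constant 1, obtained by integrating the nonnegative square of
  \<open>g - c\<close> with \<open>c\<close> the mean of g.\<close>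

lemma square_increment_le_integral:
  fixes g :: "real \<Rightarrow> real"
  assumes "a \<le> b" "(g has_integral D) {a..b}" "(\<lambda>x. (g x)\<^sup>2) integrable_on {a..b}"
  shows "D\<^sup>2 \<le> (b - a) * integral {a..b} (\<lambda>x. (g x)\<^sup>2)"
proof (cases "a = b")
  case True
  then have "(g has_integral 0) {a..b}" using has_integral_refl(2)[of g a] by simp
  then have "D = 0" using assms(2) has_integral_unique by blast
  then show ?thesis using True by simp
next
  case False
  define c where "c = D / (b - a)"
  have "((\<lambda>x. (g x)\<^sup>2 - 2 * c * g x + c\<^sup>2) has_integral
      (integral {a..b} (\<lambda>x. (g x)\<^sup>2) - 2 * c * D + c\<^sup>2 * (b - a))) {a..b}"
    using assms has_integral_const_real[of "c\<^sup>2" a b]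
    by (intro has_integral_add has_integral_diff has_integral_mult_right integrable_integral)
       (auto simp: mult.commute)
  moreover have "0 \<le> (g x)\<^sup>2 - 2 * c * g x + c\<^sup>2" for x
    using zero_le_power2[of "g x - c"] by (simp add: power2_eq_square algebra_simps)
  ultimately have "0 \<le> integral {a..b} (\<lambda>x. (g x)\<^sup>2) - 2 * c * D + c\<^sup>2 * (b - a)"
    by (rule has_integral_nonneg)
  moreover have c: "c * (b - a) = D" using False by (simp add: c_def)
  then have "c\<^sup>2 * (b - a) = c * D" by (simp add: power2_eq_square mult.assoc)
  ultimately have "c * D \<le> integral {a..b} (\<lambda>x. (g x)\<^sup>2)" by linarith
  then have "(b - a) * (c * D) \<le> (b - a) * integral {a..b} (\<lambda>x. (g x)\<^sup>2)"
    using assms(1) by (intro mult_left_mono) auto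
  moreover have "(b - a) * (c * D) = D\<^sup>2"
    unfolding power2_eq_square by (metis c mult.assoc mult.commute)
  ultimately show ?thesis by simp
qed

lemma P1_affine_on:
  assumes "u \<in> P1 y" "y (l - 1) \<le> a" "a < b" "b \<le> y l" "x \<in> {a..b}"
  shows "u x = u a + (u b - u a) / (b - a) * (x - a)"
proof -
  obtain c d where cd: "\<And>x. x \<in> {y (l - 1)..y l} \<Longrightarrow> u x = c * x + d"
    using assms(1) unfolding P1_def element_def by blast
  have u: "u a = c * a + d" "u b = c * b + d" "u x = c * x + d" using assms by (auto intro: cd)
  have "u b - u a = c * (b - a)" by (simp add: u algebra_simps)
  then have "(u b - u a) / (b - a) = c" using assms(3) nonzero_mult_div_cancel_right[of "b - a" c] by simp
  then show ?thesis by (simp add: u algebra_simps)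
qed

lemma P1_has_field_derivative:
  assumes "u \<in> P1 y" "y (l - 1) \<le> a" "a < b" "b \<le> y l" "x \<in> {a<..<b}"
  shows "(u has_field_derivative (u b - u a) / (b - a)) (at x)"
proof -
  have "((\<lambda>x. u a + (u b - u a) / (b - a) * (x - a)) has_field_derivative (u b - u a) / (b - a)) (at x)"
    using assms(3) by (auto intro!: derivative_eq_intros)
  then show ?thesis
  proof (rule has_field_derivative_transform_within_open[of _ _ _ "{a<..<b}"])
    show "u a + (u b - u a) / (b - a) * (x - a) = u x" if "x \<in> {a<..<b}" for x
      by (rule P1_affine_on[OF assms(1-4), symmetric]) (use that in auto)
  qed (use assms(5) in auto)
qed

lemma P1_deriv:
  assumes "u \<in> P1 y" "y (l - 1) \<le> a" "a < b" "b \<le> y l" "x \<in> {a<..<b}"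
  shows "deriv u x = (u b - u a) / (b - a)"
  using P1_has_field_derivative[OF assms] by (rule DERIV_imp_deriv)

text \<open>The integrand is quadratic with second derivative 2 s t, for s and t the slopes. The
  error of the trapezoidal rule on a quadratic is its second derivative times -(b - a)^3/12.\<close>

lemma has_integral_affine_product:
  fixes u w :: "real \<Rightarrow> real"
  assumes "a < b"
    and "\<And>x. x \<in> {a..b} \<Longrightarrow> u x = u a + (u b - u a) / (b - a) * (x - a)"
    and "\<And>x. x \<in> {a..b} \<Longrightarrow> w x = w a + (w b - w a) / (b - a) * (x - a)"
  shows "((\<lambda>x. u x * w x) has_integral
    (b - a) * (u a * w a + u b * w b) / 2
      - (b - a) ^ 3 / 6 * ((u b - u a) / (b - a)) * ((w b - w a) / (b - a))) {a..b}"
proof -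
  define s t where "s = (u b - u a) / (b - a)" and "t = (w b - w a) / (b - a)"
  define F where "F = (\<lambda>x. u a * w a * (x - a) + (u a * t + w a * s) * (x - a)\<^sup>2 / 2 + s * t * (x - a) ^ 3 / 3)"
  have "((\<lambda>x. u x * w x) has_integral F b - F a) {a..b}"
  proof (rule fundamental_theorem_of_calculus)
    fix x assume x: "x \<in> {a..b}"
    have "(F has_field_derivative u x * w x) (at x within {a..b})"
      unfolding F_def assms(2)[OF x] assms(3)[OF x] s_def[symmetric] t_def[symmetric]
      by (auto intro!: derivative_eq_intros simp: power2_eq_square field_simps)
    then show "(F has_vector_derivative u x * w x) (at x within {a..b})"
      by (simp add: has_real_derivative_iff_has_vector_derivative)
  qed (use assms(1) in auto)
  moreover have "F b - F a = (b - a) * (u a * w a + u b * w b) / 2 - (b - a) ^ 3 / 6 * s * t"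
  proof -
    define r where "r = b - a"
    have "u b = u a + s * r" "w b = w a + t * r" using assms(1) by (auto simp: s_def t_def r_def)
    then show ?thesis unfolding F_def r_def[symmetric] by (simp add: power2_eq_square power3_eq_cube field_simps)
  qed
  ultimately show ?thesis by (simp add: s_def t_def)
qed

text \<open>The weighted derivative term compensates the trapezoidal error: a weight with integral
  (b - a)^3/6 makes the rule exact, any other leaves an explicit multiple of the two slopes. Slopes
  and derivatives agree on the open interval, which suffices.\<close>

lemma has_integral_P1_weighted_products:
  assumes u: "u \<in> P1 y" and w: "w \<in> P1 y" and ab: "y (l - 1) \<le> a" "a < b" "b \<le> y l"
    and \<omega>: "(\<omega> has_integral W) {a..b}"
  shows "((\<lambda>x. u x * w x + \<omega> x * deriv u x * deriv w x) has_integral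
    (b - a) * (u a * w a + u b * w b) / 2
      + (W - (b - a) ^ 3 / 6) * ((u b - u a) / (b - a)) * ((w b - w a) / (b - a))) {a..b}"
proof -
  define s t where "s = (u b - u a) / (b - a)" and "t = (w b - w a) / (b - a)"
  have "((\<lambda>x. \<omega> x * (s * t)) has_integral W * (s * t)) (cbox a b)"
    using has_integral_mult_left[OF \<omega>, of "s * t"] by simp
  then have "((\<lambda>x. \<omega> x * deriv u x * deriv w x) has_integral W * (s * t)) (cbox a b)"
    by (rule has_integral_spike_interior)
       (auto simp: s_def t_def P1_deriv[OF u ab] P1_deriv[OF w ab])
  then have *: "((\<lambda>x. \<omega> x * deriv u x * deriv w x) has_integral W * (s * t)) {a..b}" by simp
  have "((\<lambda>x. u x * w x) has_integral
    (b - a) * (u a * w a + u b * w b) / 2 - (b - a) ^ 3 / 6 * s * t) {a..b}"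
    unfolding s_def t_def
    by (intro has_integral_affine_product ab P1_affine_on[OF u ab] P1_affine_on[OF w ab])
  from has_integral_add[OF this *] show ?thesis by (simp add: s_def t_def algebra_simps)
qed

section \<open>Periodic piecewise affine functions on the lattice\<close>

lemma mono_lattice_pt: "mono (lattice_pt N)"
  by (auto simp: mono_def lattice_pt_def eps_def divide_right_mono)

lemma lattice_pt_diff: "lattice_pt N l - lattice_pt N (l - 1) = eps N"
  by (simp add: lattice_pt_def algebra_simps)

lemma eps_pos: "N \<ge> 1 \<Longrightarrow> 0 < eps N"
  by (simp add: eps_def)

lemma lattice_cell_cover:
  assumes "N \<ge> 1"
  obtains l where "lattice_pt N (l - 1) < x" "x \<le> lattice_pt N l"
proof -
  have "of_int (\<lceil>x * real N\<rceil> - 1) < x * real N" "x * real N \<le> of_int \<lceil>x * real N\<rceil>" by linarith+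
  then show ?thesis using assms that[of "\<lceil>x * real N\<rceil>"]
    by (simp add: lattice_pt_def eps_def field_simps)
qed

lemma integrable_on_lattice_cells:
  assumes "N \<ge> 1" "\<And>l. g integrable_on {lattice_pt N (l - 1)..lattice_pt N l}"
  shows "(g :: real \<Rightarrow> real) integrable_on {a..b}"
proof (cases "a \<le> b")
  case True
  obtain p where p: "lattice_pt N (p - 1) < a" using lattice_cell_cover[OF assms(1), of a] by blast
  obtain q where q: "b \<le> lattice_pt N q" using lattice_cell_cover[OF assms(1), of b] by blast
  have "p - 1 \<le> q"
    using monoD[OF mono_lattice_pt, of q "p - 1" N] p q True by linarith
  then have "(g has_integral (\<Sum>j\<in>{p-1+1..q}. integral {lattice_pt N (j - 1)..lattice_pt N j} g))
      {lattice_pt N (p - 1)..lattice_pt N q}"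
    by (intro has_integral_partition_int integrable_integral assms mono_lattice_pt)
  then have "g integrable_on {lattice_pt N (p - 1)..lattice_pt N q}" by blast
  then show ?thesis
    by (rule integrable_subinterval_real)
       (use p q in auto)
qed (simp add: integrable_on_empty)

lemma integrable_P1_deriv_square:
  assumes N: "N \<ge> 1" and u: "u \<in> P1 (lattice_pt N)"
  shows "(\<lambda>x. (deriv u x)\<^sup>2) integrable_on {a..b}"
proof (rule integrable_on_lattice_cells[OF N])
  fix l
  let ?a = "lattice_pt N (l - 1)" and ?b = "lattice_pt N l"
  have "(\<lambda>x. ((u ?b - u ?a) / (?b - ?a))\<^sup>2) integrable_on cbox ?a ?b" by (rule integrable_const)
  then have "(\<lambda>x. (deriv u x)\<^sup>2) integrable_on cbox ?a ?b"
    by (rule integrable_spike_interior[rotated])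
       (use P1_deriv[OF u order_refl _ order_refl, of l] eps_pos[OF N] lattice_pt_diff[of N l] in auto)
  then show "(\<lambda>x. (deriv u x)\<^sup>2) integrable_on {?a..?b}" by simp
qed

lemma has_integral_P1_deriv:
  assumes N: "N \<ge> 1" and u: "u \<in> P1 (lattice_pt N)" and cont: "continuous_on UNIV u" and "a \<le> b"
  shows "(deriv u has_integral u b - u a) {a..b}"
proof (rule fundamental_theorem_of_calculus_interior_strong)
  \<comment> \<open>A finite set containing all lattice points of \<open>{a..b}\<close>, hence all
    possible kinks there.\<close>
  let ?S = "lattice_pt N ` {\<lfloor>a * real N\<rfloor>..\<lceil>b * real N\<rceil>}"
  show "finite ?S" by simp
  show "continuous_on {a..b} u" using cont continuous_on_subset by blast
  fix x assume x: "x \<in> {a<..<b} - ?S"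
  obtain l where l: "lattice_pt N (l - 1) < x" "x \<le> lattice_pt N l" using lattice_cell_cover[OF N] .
  have "x \<noteq> lattice_pt N l"
  proof
    assume eq: "x = lattice_pt N l"
    then have "of_int l = x * real N" using N by (simp add: lattice_pt_def eps_def)
    then have "a * real N \<le> of_int l" "of_int l \<le> b * real N" using x by (auto intro: mult_right_mono)
    then have "l \<in> {\<lfloor>a * real N\<rfloor>..\<lceil>b * real N\<rceil>}" by (simp add: floor_le_iff le_ceiling_iff)
    then show False using x eq by auto
  qed
  then have "x \<in> {lattice_pt N (l - 1)<..<lattice_pt N l}" using l by auto
  from P1_has_field_derivative[OF u order_refl _ order_refl this] eps_pos[OF N] lattice_pt_diff[of N l]
  obtain D where "(u has_field_derivative D) (at x)" by auto
  then have "(u has_field_derivative deriv u x) (at x)" by (simp add: DERIV_imp_deriv)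
  then show "(u has_vector_derivative deriv u x) (at x)"
    by (simp add: has_real_derivative_iff_has_vector_derivative)
qed (use assms in auto)

text \<open>At a kink \<open>deriv\<close> is a default value, but it is chosen from the predicate
  \<open>has_field_derivative\<close>, which is the same at \<open>x\<close> and
  \<open>x + 1\<close>; so periodicity extends to kinks.\<close>

lemma deriv_periodic:
  fixes u :: "real \<Rightarrow> real"
  assumes "\<And>x. u (x + 1) = u x"
  shows "deriv u (x + 1) = deriv u x"
proof -
  have "(\<lambda>y. u (y + 1)) = u" using assms by auto
  then have "(u has_field_derivative D) (at (x + 1)) \<longleftrightarrow> (u has_field_derivative D) (at x)" for D
    using DERIV_shift[of u D x 1] by simp
  then show ?thesis by (simp add: deriv_def)
qed

text \<open>On the circle, y is reached from x along two arcs of lengths t and 1 - t, carrying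
  energies I and 1 - I. Cauchy-Schwarz on both arcs bounds the squared difference by t (1 - t), at
  most 1/4.\<close>

lemma periodic_P1_oscillation:
  assumes N: "N \<ge> 1" and v: "v \<in> P1 (lattice_pt N)" and cont: "continuous_on UNIV v"
    and per: "\<And>x. v (x + 1) = v x" and unit: "integral {0..1} (\<lambda>x. (deriv v x)\<^sup>2) = 1"
    and xy: "x \<le> y" "y \<le> x + 1"
  shows "\<bar>v y - v x\<bar> \<le> 1 / 2"
proof -
  let ?g = "\<lambda>x. (deriv v x)\<^sup>2"
  note int = integrable_P1_deriv_square[OF N v]
  have "(v y - v x)\<^sup>2 \<le> (y - x) * integral {x..y} ?g"
    using xy int by (intro square_increment_le_integral has_integral_P1_deriv[OF N v cont]) auto
  moreover have "(v (x + 1) - v y)\<^sup>2 \<le> (x + 1 - y) * integral {y..x + 1} ?g"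
    using xy int by (intro square_increment_le_integral has_integral_P1_deriv[OF N v cont]) auto
  moreover have "integral {x..y} ?g + integral {y..x + 1} ?g = 1"
    using Henstock_Kurzweil_Integration.integral_combine[OF xy int] integral_unit_interval_periodic[of ?g x] deriv_periodic[of v] per int unit
    by simp
  moreover define t I where "t = y - x" and "I = integral {x..y} ?g"
  ultimately have ineqs: "(v y - v x)\<^sup>2 \<le> t * I" "(v y - v x)\<^sup>2 \<le> (1 - t) * (1 - I)"
  proof -
    assume *: "(v y - v x)\<^sup>2 \<le> (y - x) * integral {x..y} ?g"
      "(v (x + 1) - v y)\<^sup>2 \<le> (x + 1 - y) * integral {y..x + 1} ?g"
      "integral {x..y} ?g + integral {y..x + 1} ?g = 1"
    show "(v y - v x)\<^sup>2 \<le> t * I" using * by (simp add: t_def I_def)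
    have "integral {y..x + 1} ?g = 1 - I" "x + 1 - y = 1 - t" "v (x + 1) - v y = - (v y - v x)"
      using * per[of x] by (simp_all add: t_def I_def)
    then show "(v y - v x)\<^sup>2 \<le> (1 - t) * (1 - I)" using *(2) by (simp only: power2_minus)
  qed
  have t: "0 \<le> t" "t \<le> 1" using xy by (auto simp: t_def)
  \<comment> \<open>The convex weights 1 - t and t are those that eliminate the unknown energy
    \<open>I\<close>.\<close>
  have "(1 - t) * (v y - v x)\<^sup>2 \<le> (1 - t) * (t * I)" "t * (v y - v x)\<^sup>2 \<le> t * ((1 - t) * (1 - I))"
    using ineqs t by (auto intro!: mult_left_mono)
  then have "(1 - t) * (v y - v x)\<^sup>2 + t * (v y - v x)\<^sup>2 \<le> (1 - t) * (t * I) + t * ((1 - t) * (1 - I))"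
    by (rule add_mono)
  then have "(v y - v x)\<^sup>2 \<le> t * (1 - t)" by (simp add: algebra_simps)
  also have "\<dots> = (1 / 2)\<^sup>2 - (t - 1 / 2)\<^sup>2" by (simp add: power2_eq_square algebra_simps)
  also have "\<dots> \<le> (1 / 2)\<^sup>2" by simp
  finally have "\<bar>v y - v x\<bar> \<le> \<bar>1 / 2\<bar>" by (simp only: abs_le_square_iff)
  then show ?thesis by simp
qed

section \<open>Geometry of the mesh and its refinement\<close>

locale refined_mesh =
  fixes N K :: nat and Oa Oc :: "real set" and xh xr :: "int \<Rightarrow> real"
  assumes N: "N \<ge> 1"
    and reg: "regions N Oa Oc"
    and mesh: "fe_mesh N K Oa Oc xh"
    and ref: "is_common_refinement N xh xr"
begin

abbreviation "J \<equiv> ref_index xh xr"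
abbreviation "lat \<equiv> lattice_pt N"

lemma eps: "0 < eps N" by (rule eps_pos[OF N])

lemma closed_Oc: "closed Oc"
  and cover: "Oa \<union> Oc = UNIV"
  and Oc_periodic: "x + 1 \<in> Oc \<longleftrightarrow> x \<in> Oc"
  and Oc_intervals: "\<exists>I. (\<forall>(a, b)\<in>I. a < b) \<and> Oc = (\<Union>(a, b)\<in>I. {a..b})"
  using reg unfolding regions_def by blast+

lemma xh_strict_mono: "strict_mono xh"
  and xh_periodic: "xh (k + int K) = xh k + 1"
  and xh_period: "xh k \<in> {0<..1} \<longleftrightarrow> k \<in> {1..int K}"
  and lattice_in_Oa: "lat l \<in> Oa \<Longrightarrow> lat l \<in> range xh"
  and xh_notin_Oc: "xh k \<notin> Oc \<Longrightarrow> xh k \<in> range lat"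
  and frontier_Oc: "frontier Oc \<subseteq> range xh"
  and element_length: "element xh k \<subseteq> Oc \<Longrightarrow> 2 * eps N \<le> xh k - xh (k - 1)"
  using mesh unfolding fe_mesh_def by blast+

lemma xr_strict_mono: "strict_mono xr" and range_xr: "range xr = range lat \<union> range xh"
  using ref unfolding is_common_refinement_def by auto

lemma xh_less_iff [simp]: "xh i < xh j \<longleftrightarrow> i < j"
  and xh_le_iff [simp]: "xh i \<le> xh j \<longleftrightarrow> i \<le> j"
  using xh_strict_mono by (simp_all add: strict_mono_less strict_mono_less_eq)

lemma xr_less_iff [simp]: "xr i < xr j \<longleftrightarrow> i < j"
  and xr_le_iff [simp]: "xr i \<le> xr j \<longleftrightarrow> i \<le> j"
  using xr_strict_mono by (simp_all add: strict_mono_less strict_mono_less_eq)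

lemma xr_J [simp]: "xr (J k) = xh k"
proof -
  obtain j where "xr j = xh k" using range_xr by (metis UnI2 rangeE rangeI)
  then have "\<exists>!j. xr j = xh k" using strict_mono_eq[OF xr_strict_mono] by metis
  then show ?thesis unfolding ref_index_def by (rule theI')
qed

lemma J_less_iff [simp]: "J i < J j \<longleftrightarrow> i < j"
  using xr_less_iff[of "J i" "J j"] by simp

lemma mono_J: "mono J"
  by (rule monoI) (metis J_less_iff linorder_not_less)

lemma lat_in_xr: obtains i where "xr i = lat l"
  using range_xr by (metis UnI1 rangeE rangeI)

text \<open>Lattice points are refined nodes, so none lies strictly inside a refined cell.\<close>

lemma refined_cell_in_lattice_cell:
  obtains l where "lat (l - 1) \<le> xr (j - 1)" "xr j \<le> lat l"
proof -
  obtain l where l: "lat (l - 1) < xr j" "xr j \<le> lat l" using lattice_cell_cover[OF N] .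
  obtain i where i: "xr i = lat (l - 1)" by (rule lat_in_xr)
  have "i < j" using l(1) i xr_less_iff[of i j] by simp
  then have "lat (l - 1) \<le> xr (j - 1)" using i xr_le_iff[of i "j - 1"] by simp
  then show ?thesis using that l by blast
qed

lemma refined_cell_length: "0 < xr j - xr (j - 1)" "xr j - xr (j - 1) \<le> eps N"
proof -
  show "0 < xr j - xr (j - 1)" using xr_less_iff[of "j - 1" j] by linarith
  obtain l where "lat (l - 1) \<le> xr (j - 1)" "xr j \<le> lat l" by (rule refined_cell_in_lattice_cell)
  then show "xr j - xr (j - 1) \<le> eps N" using lattice_pt_diff[of N l] by linarith
qed

text \<open>An open element is connected and contains no frontier point of \<open>Oc\<close>, since
  those are nodes. If it met \<open>Oc\<close> it would lie in it, and closedness would put the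
  closed element there too.\<close>

lemma interior_disjoint_Oc:
  assumes "\<not> element xh k \<subseteq> Oc"
  shows "{xh (k - 1)<..<xh k} \<inter> Oc = {}"
proof (rule ccontr)
  let ?S = "{xh (k - 1)<..<xh k}"
  assume "?S \<inter> Oc \<noteq> {}"
  have "?S \<inter> frontier Oc = {}"
  proof -
    have "xh i \<notin> ?S" for i by auto
    then show ?thesis using frontier_Oc by blast
  qed
  then have "?S - Oc = {}"
    using connected_Int_frontier[of ?S Oc] \<open>?S \<inter> Oc \<noteq> {}\<close> by auto
  then have "closure ?S \<subseteq> Oc" using closed_Oc by (intro closure_minimal) auto
  then show False using assms by (simp add: element_def)
qed

text \<open>A refined node strictly inside such an element would be a lattice point off
  \<open>Oc\<close>, hence in \<open>Oa\<close>, hence a mesh node.\<close>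

lemma J_step_outside_Oc:
  assumes "\<not> element xh k \<subseteq> Oc"
  shows "J (k - 1) = J k - 1"
proof (rule ccontr)
  assume "J (k - 1) \<noteq> J k - 1"
  moreover have "J (k - 1) < J k" by simp
  ultimately have j: "J (k - 1) < J k - 1" "J k - 1 < J k" by linarith+
  let ?x = "xr (J k - 1)"
  have x: "xh (k - 1) < ?x" "?x < xh k" using j by (metis xr_J xr_less_iff)+
  have "?x \<notin> range xh"
  proof
    assume "?x \<in> range xh"
    then obtain i where "?x = xh i" by blast
    then show False using x by auto
  qed
  then obtain l where l: "?x = lat l" using range_xr by (metis UnE rangeE rangeI)
  have "?x \<notin> Oc" using interior_disjoint_Oc[OF assms] x by auto
  then have "lat l \<in> Oa" using cover l by auto
  then show False using lattice_in_Oa l \<open>?x \<notin> range xh\<close> by simp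
qed

text \<open>A single refined cell is too short to fill an element of length at least
  \<open>2 * eps N\<close>. The interior node obtained here is what the element estimate relies
  on.\<close>

lemma J_step_in_Oc:
  assumes "element xh k \<subseteq> Oc"
  shows "J (k - 1) + 2 \<le> J k"
proof (rule ccontr)
  assume "\<not> J (k - 1) + 2 \<le> J k"
  moreover have "J (k - 1) < J k" by simp
  ultimately have "J k - 1 = J (k - 1)" by linarith
  then have "xh k - xh (k - 1) \<le> eps N" using refined_cell_length(2)[of "J k"] by simp
  then show False using element_length[OF assms] eps by linarith
qed

text \<open>A node off the lattice lies in \<open>Oc\<close>, thus in one of its nondegenerate
  closed intervals, which reaches into the interior of one of the two neighbouring elements.\<close>

lemma adjacent_element_in_Oc:
  assumes "xh k \<notin> range lat"
  shows "element xh k \<subseteq> Oc \<or> element xh (k + 1) \<subseteq> Oc"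
proof (rule ccontr)
  assume *: "\<not> ?thesis"
  have left: "{xh (k - 1)<..<xh k} \<inter> Oc = {}" and right: "{xh k<..<xh (k + 1)} \<inter> Oc = {}"
    using * interior_disjoint_Oc[of k] interior_disjoint_Oc[of "k + 1"] by auto
  have "xh k \<in> Oc" using assms xh_notin_Oc by blast
  then obtain a b where ab: "a < b" "{a..b} \<subseteq> Oc" "xh k \<in> {a..b}" using Oc_intervals by blast
  have lr: "xh (k - 1) < xh k" "xh k < xh (k + 1)" by simp_all
  show False
  proof (cases "xh k < b")
    case True
    obtain z where "xh k < z" "z < min b (xh (k + 1))" using dense[of "xh k" "min b (xh (k + 1))"] True lr by auto
    then have "z \<in> {a..b}" "z \<in> {xh k<..<xh (k + 1)}" using ab by auto
    then show False using ab(2) right by blast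
  next
    case False
    obtain z where "max a (xh (k - 1)) < z" "z < xh k" using dense[of "max a (xh (k - 1))" "xh k"] False ab lr by auto
    then have "z \<in> {a..b}" "z \<in> {xh (k - 1)<..<xh k}" using ab by auto
    then show False using ab(2) left by blast
  qed
qed

section \<open>The continuum part of a lattice cell and the quadrature weight\<close>

lemma indicator_Oc_integrable: "indicat_real Oc integrable_on {a..b}"
proof -
  have "compact (Oc \<inter> {a..b})" using closed_Oc by (intro closed_Int_compact) auto
  then show ?thesis by (simp add: integrable_on_indicator lmeasurable_compact)
qed

text \<open>The length of the part of lattice cell \<open>l\<close> outside
  \<open>Oc\<close>.\<close>

definition gap :: "int \<Rightarrow> real" where
  "gap l = eps N - integral {lat (l - 1)..lat l} (indicat_real Oc)"

lemma gap_bounds: "0 \<le> gap l" "gap l \<le> eps N"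
proof -
  let ?I = "integral {lat (l - 1)..lat l} (indicat_real Oc)"
  have le: "lat (l - 1) \<le> lat l" using lattice_pt_diff[of N l] eps by linarith
  have "0 \<le> ?I" by (rule integral_nonneg[OF indicator_Oc_integrable]) auto
  then show "gap l \<le> eps N" by (simp add: gap_def)
  have "?I \<le> integral {lat (l - 1)..lat l} (\<lambda>x. 1)"
    by (rule integral_le[OF indicator_Oc_integrable]) (auto simp: indicator_def)
  then show "0 \<le> gap l" using le by (simp add: gap_def lattice_pt_diff)
qed

lemma gap_periodic: "gap (l + int N) = gap l"
proof -
  have shift: "lat (i + int N) = lat i + 1" for i
    using N by (simp add: lattice_pt_def eps_def field_simps)
  have "integral {lat (l - 1) + of_int 1..lat l + of_int 1} (indicat_real Oc) = integral {lat (l - 1)..lat l} (indicat_real Oc)"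
    by (intro integral_unique has_integral_shift_periodic integrable_integral indicator_Oc_integrable)
       (simp add: indicator_def Oc_periodic)
  then show ?thesis using shift[of l] shift[of "l - 1"] by (simp add: gap_def algebra_simps)
qed

text \<open>The rest of the lattice cell lies in \<open>Oc\<close>. An end of the element inside the
  cell is no lattice point, so the neighbour there is in the continuum region, and its length of at
  least \<open>2 * eps N\<close> carries it to the end of the cell.\<close>

lemma gap_eq_element_length:
  assumes k: "\<not> element xh k \<subseteq> Oc" and l: "lat (l - 1) \<le> xh (k - 1)" "xh k \<le> lat l"
  shows "gap l = xh k - xh (k - 1)"
proof -
  let ?c = "indicat_real Oc"
  have less: "xh (k - 1) < xh k" by simp
  have not_lat: "x \<notin> range lat" if "lat (l - 1) < x" "x < lat l" for x
  proof
    assume "x \<in> range lat"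
    then obtain i where "x = lat i" by blast
    then have "l - 1 < i" "i < l"
      using that eps by (auto simp: lattice_pt_def mult_less_cancel_right)
    then show False by linarith
  qed
  have left: "{lat (l - 1)..xh (k - 1)} \<subseteq> Oc" if "lat (l - 1) < xh (k - 1)"
  proof -
    have "element xh (k - 1) \<subseteq> Oc"
      using adjacent_element_in_Oc[of "k - 1"] not_lat[OF that] less l k by auto
    moreover from element_length[OF this] have "xh (k - 1 - 1) \<le> lat (l - 1)"
      using l less eps lattice_pt_diff[of N l] by linarith
    then have "{lat (l - 1)..xh (k - 1)} \<subseteq> element xh (k - 1)" by (simp add: element_def)
    ultimately show ?thesis by blast
  qed
  have right: "{xh k..lat l} \<subseteq> Oc" if "xh k < lat l"
  proof -
    have "element xh (k + 1) \<subseteq> Oc"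
      using adjacent_element_in_Oc[of k] not_lat[OF _ that] less l k by auto
    moreover from element_length[OF this] have "lat l \<le> xh (k + 1)"
      using l less eps lattice_pt_diff[of N l] by (simp only: add_diff_cancel_right')
    then have "{xh k..lat l} \<subseteq> element xh (k + 1)" by (simp add: element_def)
    ultimately show ?thesis by blast
  qed
  have full: "(?c has_integral b - a) {a..b}" if "a < b \<Longrightarrow> {a..b} \<subseteq> Oc" "a \<le> b" for a b
  proof (cases "a < b")
    case True
    have "((\<lambda>x. 1 :: real) has_integral b - a) {a..b}" using has_integral_const_real[of "1 :: real" a b] True by simp
    then show ?thesis by (rule has_integral_eq[rotated]) (use that True in \<open>auto simp: indicator_def\<close>)
  qed (use that has_integral_refl(2)[of ?c a] in auto)
  have "(?c has_integral 0) (cbox (xh (k - 1)) (xh k))"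
    by (rule has_integral_spike_interior[OF has_integral_0])
       (use interior_disjoint_Oc[OF k] in \<open>auto simp: indicator_def\<close>)
  then have "(?c has_integral (xh (k - 1) - lat (l - 1)) + 0) {lat (l - 1)..xh k}"
    using less l left by (intro has_integral_combine[OF _ _ full]) auto
  then have "(?c has_integral ((xh (k - 1) - lat (l - 1)) + 0) + (lat l - xh k)) {lat (l - 1)..lat l}"
    using order_trans[OF l(1) less_imp_le[OF less]] l right by (intro has_integral_combine[OF _ _ _ full]) auto
  then show ?thesis using lattice_pt_diff[of N l] unfolding gap_def by (simp add: integral_unique)
qed

text \<open>Integrating \<open>f w + weight f' w'\<close> over a lattice cell gives exactly the trapezoidal rule of the
  lattice. The weight is not constant: on an element outside the continuum region it has to
  reproduce the trapezoidal rule of that element, so that the whole quadrature error of the lattice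
  cell is charged to its continuum part.\<close>

definition weight :: "real \<Rightarrow> real" where
  "weight x = (let r = gap \<lceil>x * real N\<rceil> in (r\<^sup>2 + indicator Oc x * ((eps N)\<^sup>2 + eps N * r)) / 6)"

lemma weight_periodic: "weight (x + 1) = weight x"
proof -
  have "(x + 1) * real N = x * real N + of_int (int N)" by (simp add: distrib_right)
  then have "\<lceil>(x + 1) * real N\<rceil> = \<lceil>x * real N\<rceil> + int N" by (simp only: ceiling_add_of_int)
  then show ?thesis by (simp add: weight_def gap_periodic indicator_def Oc_periodic)
qed

lemma has_integral_weight:
  assumes "lat (l - 1) \<le> a" "a \<le> b" "b \<le> lat l" and S: "(indicat_real Oc has_integral S) {a..b}"
  shows "(weight has_integral ((b - a) * (gap l)\<^sup>2 + S * ((eps N)\<^sup>2 + eps N * gap l)) / 6) {a..b}"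
proof -
  let ?r = "gap l"
  have "((\<lambda>x. (?r\<^sup>2 + indicat_real Oc x * ((eps N)\<^sup>2 + eps N * ?r)) / 6) has_integral
      ((b - a) * ?r\<^sup>2 + S * ((eps N)\<^sup>2 + eps N * ?r)) / 6) (cbox a b)"
    using has_integral_const_real[of "?r\<^sup>2" a b] assms
    by (intro has_integral_divide has_integral_add has_integral_mult_left) auto
  then have "(weight has_integral ((b - a) * ?r\<^sup>2 + S * ((eps N)\<^sup>2 + eps N * ?r)) / 6) (cbox a b)"
  \<comment> \<open>The ceiling assigns the left end point of the lattice cell to cell
    \<open>l - 1\<close>, so the formula is compared in the interior.\<close>
  proof (rule has_integral_spike_interior)
    fix x assume "x \<in> box a b"
    then have "lat (l - 1) < x" "x < lat l" using assms by auto
    then have "\<lceil>x * real N\<rceil> = l" using N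
      by (intro ceiling_unique) (auto simp: lattice_pt_def eps_def field_simps)
    then show "weight x = (?r\<^sup>2 + indicat_real Oc x * ((eps N)\<^sup>2 + eps N * ?r)) / 6"
      by (simp add: weight_def Let_def)
  qed
  then show ?thesis by simp
qed

text \<open>With r the gap, the part outside \<open>Oc\<close> contributes r^3/6 and the part inside
  (eps - r) (eps^2 + eps r + r^2)/6 = (eps^3 - r^3)/6.\<close>

lemma has_integral_weight_lattice_cell: "(weight has_integral (eps N) ^ 3 / 6) {lat (l - 1)..lat l}"
proof -
  have "(weight has_integral ((lat l - lat (l - 1)) * (gap l)\<^sup>2
      + (eps N - gap l) * ((eps N)\<^sup>2 + eps N * gap l)) / 6) {lat (l - 1)..lat l}"
  proof (rule has_integral_weight)
    show "(indicat_real Oc has_integral (eps N - gap l)) {lat (l - 1)..lat l}"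
      using integrable_integral[OF indicator_Oc_integrable] by (simp add: gap_def)
    show "lat (l - 1) \<le> lat l" using lattice_pt_diff[of N l] eps by linarith
  qed auto
  moreover have "eps N * r\<^sup>2 + (eps N - r) * ((eps N)\<^sup>2 + eps N * r) = (eps N) ^ 3" for r
    by (simp add: power2_eq_square power3_eq_cube algebra_simps)
  ultimately show ?thesis by (simp add: lattice_pt_diff)
qed

section \<open>Discrete inner products as sums over mesh elements\<close>

lemma sum_elements:
  "(\<Sum>k\<in>{1..int K}. \<Sum>j\<in>{J (k - 1) + 1..J k}. g j) = (\<Sum>j\<in>{J 0 + 1..J (int K)}. g j)"
  by (rule sum_blocks_int[OF mono_J])

lemma sum_element_lengths: "(\<Sum>k\<in>{1..int K}. xh k - xh (k - 1)) = 1"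
proof -
  have "(\<Sum>k\<in>{0+1..int K}. xh k - xh (k - 1)) = xh (int K) - xh 0" by (rule sum_telescope_int) simp
  then show ?thesis using xh_periodic[of 0] by simp
qed

text \<open>A nodal weight is half the length of the two adjacent elements; the half from the right
  element is handed to that element by a periodic index shift.\<close>

lemma sum_element_trapezoids:
  assumes "\<And>x. g (x + 1) = g x"
  shows "(\<Sum>k\<in>{1..int K}. 1 / 2 * (xh (k + 1) - xh (k - 1)) * g (xh k))
    = (\<Sum>k\<in>{1..int K}. (xh k - xh (k - 1)) * (g (xh (k - 1)) + g (xh k)) / 2)"
proof -
  let ?G = "\<lambda>k. (xh (k + 1) - xh k) * g (xh k) / 2"
  have "?G (k + int K) = ?G k" for k
  proof -
    have "xh (k + int K + 1) = xh (k + 1) + 1" using xh_periodic[of "k + 1"] by (simp add: add_ac)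
    then show ?thesis by (simp add: xh_periodic assms)
  qed
  then have "(\<Sum>k\<in>{1..int K}. ?G (k - 1)) = (\<Sum>k\<in>{1..int K}. ?G k)" by (rule sum_shift_periodic_int)
  moreover have "(\<Sum>k\<in>{1..int K}. 1 / 2 * (xh (k + 1) - xh (k - 1)) * g (xh k))
    = (\<Sum>k\<in>{1..int K}. (xh k - xh (k - 1)) * g (xh k) / 2) + (\<Sum>k\<in>{1..int K}. ?G k)"
    unfolding sum.distrib[symmetric] by (rule sum.cong) (auto simp: field_simps)
  moreover have "(\<Sum>k\<in>{1..int K}. (xh k - xh (k - 1)) * (g (xh (k - 1)) + g (xh k)) / 2)
    = (\<Sum>k\<in>{1..int K}. (xh k - xh (k - 1)) * g (xh k) / 2) + (\<Sum>k\<in>{1..int K}. ?G (k - 1))"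
    unfolding sum.distrib[symmetric] by (rule sum.cong) (auto simp: field_simps)
  ultimately show ?thesis by simp
qed

lemma inner_h_J_U:
  "inner_h K xh f (J_U K xh v) = (\<Sum>k\<in>{1..int K}. 1 / 2 * (xh (k + 1) - xh (k - 1))
     * (f (xh k) * (v (xh k) - 1 / 2 * (\<Sum>k\<in>{1..int K}. (xh (k + 1) - xh (k - 1)) * v (xh k)))))"
proof -
  have "nodal_interp xh v (xh k) = v (xh k)" for k
  proof -
    \<comment> \<open>The search interval in \<open>nodal_interp\<close> is open on the left, so a
      node is found as the right end of element \<open>k\<close>, not as the left end of
      \<open>k + 1\<close>.\<close>
    have "(THE i. xh (i - 1) < xh k \<and> xh k \<le> xh i) = k" by (rule the_equality) auto
    moreover have "xh k - xh (k - 1) \<noteq> 0" using xh_less_iff[of "k - 1" k] by linarith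
    ultimately show ?thesis by (simp add: nodal_interp_def)
  qed
  then show ?thesis by (simp add: inner_h_def J_U_def mult.assoc)
qed

text \<open>On each lattice cell the weight has just the integral that cancels the trapezoidal
  error, and periodicity merges the trapezoids into nodal sums. Integrability on all intervals
  permits moving the period window.\<close>

lemma inner_eps_eq_integral:
  assumes f: "f \<in> P1 lat" "\<And>x. f (x + 1) = f x" and w: "w \<in> P1 lat" "\<And>x. w (x + 1) = w x"
  shows "((\<lambda>x. f x * w x + weight x * deriv f x * deriv w x) has_integral inner_eps N f w) {0..1}"
    and "(\<lambda>x. f x * w x + weight x * deriv f x * deriv w x) integrable_on {a..b}"
proof -
  let ?\<Psi> = "\<lambda>x. f x * w x + weight x * deriv f x * deriv w x"
  let ?g = "\<lambda>l. f (lat l) * w (lat l)"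
  have cell: "(?\<Psi> has_integral eps N * (?g (l - 1) + ?g l) / 2) {lat (l - 1)..lat l}" for l
    using has_integral_P1_weighted_products[where a = "lat (l - 1)" and b = "lat l",
        OF f(1) w(1) order_refl _ order_refl has_integral_weight_lattice_cell]
      eps lattice_pt_diff[of N l] by simp
  show "?\<Psi> integrable_on {a..b}"
    by (rule integrable_on_lattice_cells[OF N]) (rule has_integral_integrable[OF cell])
  have "(?\<Psi> has_integral (\<Sum>l\<in>{0+1..int N}. eps N * (?g (l - 1) + ?g l) / 2)) {lat 0..lat (int N)}"
    using cell by (intro has_integral_partition_int mono_lattice_pt) auto
  moreover have "lat 0 = 0" "lat (int N) = 1" using N by (auto simp: lattice_pt_def eps_def)
  moreover have "(\<Sum>l\<in>{0+1..int N}. eps N * (?g (l - 1) + ?g l) / 2) = inner_eps N f w"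
  proof -
    have "lat (l + int N) = lat l + 1" for l using N by (simp add: lattice_pt_def eps_def field_simps)
    then have "(\<Sum>l\<in>{1..int N}. ?g (l - 1)) = (\<Sum>l\<in>{1..int N}. ?g l)"
      using f(2) w(2) by (intro sum_shift_periodic_int) simp
    moreover have "(\<Sum>l\<in>{0+1..int N}. eps N * (?g (l - 1) + ?g l) / 2)
      = eps N / 2 * ((\<Sum>l\<in>{1..int N}. ?g (l - 1)) + (\<Sum>l\<in>{1..int N}. ?g l))"
      unfolding sum.distrib[symmetric] sum_distrib_left by (rule sum.cong) auto
    ultimately show ?thesis by (simp add: inner_eps_def sum_distrib_left mult.assoc)
  qed
  ultimately show "(?\<Psi> has_integral inner_eps N f w) {0..1}" by simp
qed

section \<open>Error of the external forces\<close>

text \<open>The integral representing the lattice inner product is moved to the mesh-aligned period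
  starting at \<open>xh 0\<close> and evaluated on the refined cells. The load collects what the
  weight leaves beyond their trapezoids.\<close>

lemma refined_trapezoids_with_load:
  assumes f: "f \<in> P1 lat" "\<And>x. f (x + 1) = f x" and w: "w \<in> P1 lat" "\<And>x. w (x + 1) = w x"
  defines "s \<equiv> ref_size xr" and "D \<equiv> ref_diff xr f" and "\<Delta> \<equiv> \<lambda>j. w (xr j) - w (xr (j - 1))"
  shows "\<exists>e. (\<forall>k j. element xh k \<subseteq> Oc \<longrightarrow> j \<in> {J (k - 1) + 1..J k} \<longrightarrow> 0 \<le> e j \<and> e j \<le> (eps N)\<^sup>2 / 2)
    \<and> (\<forall>k. \<not> element xh k \<subseteq> Oc \<longrightarrow> e (J k) = 0)
    \<and> inner_eps N f w = (\<Sum>k\<in>{1..int K}. \<Sum>j\<in>{J (k - 1) + 1..J k}.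
       s j * (f (xr (j - 1)) * w (xr (j - 1)) + f (xr j) * w (xr j)) / 2 + e j * D j * \<Delta> j)"
proof -
  let ?\<Psi> = "\<lambda>x. f x * w x + weight x * deriv f x * deriv w x"
  define S where "S = (\<lambda>j. integral {xr (j - 1)..xr j} (indicat_real Oc))"
  have "\<exists>l. lat (l - 1) \<le> xr (j - 1) \<and> xr j \<le> lat l" for j
    using refined_cell_in_lattice_cell by metis
  then obtain L where L: "lat (L j - 1) \<le> xr (j - 1)" "xr j \<le> lat (L j)" for j by metis
  define W where "W = (\<lambda>j. (s j * (gap (L j))\<^sup>2 + S j * ((eps N)\<^sup>2 + eps N * gap (L j))) / 6)"
  \<comment> \<open>Mean weight on the cell minus s^2/6, the value at which the trapezoidal rule of
    the cell would be exact.\<close>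
  define e where "e = (\<lambda>j. W j / s j - (s j)\<^sup>2 / 6)"
  have s: "0 < s j" "s j \<le> eps N" for j
    using refined_cell_length[of j] by (auto simp: s_def ref_size_def)
  have cell: "(?\<Psi> has_integral s j * (f (xr (j - 1)) * w (xr (j - 1)) + f (xr j) * w (xr j)) / 2
      + e j * D j * \<Delta> j) {xr (j - 1)..xr j}" for j
  proof -
    have "(weight has_integral W j) {xr (j - 1)..xr j}"
      unfolding W_def s_def ref_size_def S_def
      by (rule has_integral_weight[OF L(1) _ L(2)])
         (auto intro!: integrable_integral indicator_Oc_integrable)
    then have "(?\<Psi> has_integral s j * (f (xr (j - 1)) * w (xr (j - 1)) + f (xr j) * w (xr j)) / 2
      + (W j - s j ^ 3 / 6) * D j * (\<Delta> j / s j)) {xr (j - 1)..xr j}"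
      unfolding s_def ref_size_def D_def ref_diff_def \<Delta>_def
      by (rule has_integral_P1_weighted_products[OF f(1) w(1) L(1) _ L(2), rotated]) simp
    moreover have "(W j - s j ^ 3 / 6) * D j * (\<Delta> j / s j) = e j * D j * \<Delta> j"
      using s(1)[of j] by (simp add: e_def power2_eq_square power3_eq_cube field_simps)
    ultimately show ?thesis by simp
  qed
  have load_in: "0 \<le> e j \<and> e j \<le> (eps N)\<^sup>2 / 2"
    if k: "element xh k \<subseteq> Oc" and j: "j \<in> {J (k - 1) + 1..J k}" for k j
  proof -
    have "xr (J (k - 1)) \<le> xr (j - 1)" "xr j \<le> xr (J k)" using j by (simp_all only: xr_le_iff) auto
    then have "{xr (j - 1)..xr j} \<subseteq> Oc" using k by (auto simp: element_def)
    then have "S j = integral {xr (j - 1)..xr j} (\<lambda>x. 1)"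
      unfolding S_def by (intro integral_cong) (auto simp: indicator_def)
    then have "S j = s j" using s(1)[of j] by (simp add: s_def ref_size_def)
    \<comment> \<open>Since s and the gap are at most \<open>eps N\<close>, the right-hand side lies
      between 0 and three times \<open>(eps N)^2\<close>.\<close>
    then have "6 * e j = (gap (L j))\<^sup>2 + (eps N)\<^sup>2 + eps N * gap (L j) - (s j)\<^sup>2"
      using s(1)[of j] by (simp add: e_def W_def power2_eq_square field_simps)
    moreover have "(s j)\<^sup>2 \<le> (eps N)\<^sup>2" using s[of j] by (intro power_mono) auto
    moreover have "(gap (L j))\<^sup>2 \<le> (eps N)\<^sup>2" using gap_bounds by (intro power_mono) auto
    moreover have "0 \<le> eps N * gap (L j)" "eps N * gap (L j) \<le> eps N * eps N"
      using gap_bounds[of "L j"] eps by (auto intro: mult_left_mono)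
    ultimately show ?thesis using zero_le_power2[of "gap (L j)"] zero_le_power2[of "s j"]
      unfolding power2_eq_square[of "eps N"] by linarith
  qed
  \<comment> \<open>The element is one refined cell whose length equals the gap r, and off
    \<open>Oc\<close> the weight is r^2/6, the exact value.\<close>
  have load_out: "e (J k) = 0" if k: "\<not> element xh k \<subseteq> Oc" for k
  proof -
    have J: "xr (J k - 1) = xh (k - 1)" by (simp add: J_step_outside_Oc[OF k, symmetric])
    have "(indicat_real Oc has_integral 0) (cbox (xr (J k - 1)) (xr (J k)))"
      by (rule has_integral_spike_interior[OF has_integral_0])
         (use interior_disjoint_Oc[OF k] J in \<open>auto simp: indicator_def\<close>)
    then have "S (J k) = 0" by (simp add: S_def integral_unique)
    moreover have "gap (L (J k)) = s (J k)"
      using gap_eq_element_length[OF k, of "L (J k)"] L[of "J k"] J by (simp add: s_def ref_size_def)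
    ultimately show ?thesis using s(1)[of "J k"] by (simp add: e_def W_def)
  qed
  have "(?\<Psi> has_integral (\<Sum>j\<in>{J 0 + 1..J (int K)}.
      s j * (f (xr (j - 1)) * w (xr (j - 1)) + f (xr j) * w (xr j)) / 2 + e j * D j * \<Delta> j)) {xr (J 0)..xr (J (int K))}"
    by (intro has_integral_partition_int cell monoD[OF mono_J] strict_mono_mono[OF xr_strict_mono]) simp
  then have "integral {xh 0..xh 0 + 1} ?\<Psi> = (\<Sum>j\<in>{J 0 + 1..J (int K)}.
      s j * (f (xr (j - 1)) * w (xr (j - 1)) + f (xr j) * w (xr j)) / 2 + e j * D j * \<Delta> j)"
    using xh_periodic[of 0] by (simp add: integral_unique)
  moreover have "integral {xh 0..xh 0 + 1} ?\<Psi> = integral {0..1} ?\<Psi>"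
    by (rule integral_unit_interval_periodic)
       (use f w inner_eps_eq_integral(2)[OF f w] in \<open>auto simp: weight_periodic deriv_periodic\<close>)
  moreover have "integral {0..1} ?\<Psi> = inner_eps N f w"
    by (rule integral_unique) (rule inner_eps_eq_integral(1)[OF f w])
  ultimately have "inner_eps N f w = (\<Sum>k\<in>{1..int K}. \<Sum>j\<in>{J (k - 1) + 1..J k}.
       s j * (f (xr (j - 1)) * w (xr (j - 1)) + f (xr j) * w (xr j)) / 2 + e j * D j * \<Delta> j)"
    by (simp add: sum_elements)
  moreover have "\<forall>k j. element xh k \<subseteq> Oc \<longrightarrow> j \<in> {J (k - 1) + 1..J k} \<longrightarrow> 0 \<le> e j \<and> e j \<le> (eps N)\<^sup>2 / 2"
    using load_in by blast
  moreover have "\<forall>k. \<not> element xh k \<subseteq> Oc \<longrightarrow> e (J k) = 0" using load_out by blast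
  ultimately show ?thesis by (intro exI[of _ e] conjI)
qed

text \<open>All terms under the root are nonnegative, and \<open>ref_count\<close> times
  \<open>eps N\<close> is at least 1 because the \<open>N\<close> lattice points of a period are
  among the counted nodes.\<close>

lemma eta_ext_square_ge:
  fixes f :: "real \<Rightarrow> real"
  assumes k: "element xh k \<subseteq> Oc"
  shows "(of_int (J k - J (k - 1)) * eps N / 2)\<^sup>2 * (\<Sum>i\<in>{J (k - 1) + 1..J k - 1}. ref_avg xr i * (f (xr i))\<^sup>2)
      + h_hat N xh xr k ^ 4 / 64 * (\<Sum>i\<in>{J (k - 1) + 1..J k - 1}. ref_avg xr i * (ref_diff2 xr f i)\<^sup>2)
      + h_hat N xh xr k ^ 4 * (\<Sum>j\<in>{J (k - 1) + 1..J k}. ref_size xr j * (ref_diff xr f j)\<^sup>2)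
    \<le> (eta_ext N K xh xr f k)\<^sup>2"
proof -
  define A1 where "A1 = (\<Sum>i\<in>{J (k - 1) + 1..J k - 1}. ref_avg xr i * (f (xr i))\<^sup>2)"
  define A2 where "A2 = (\<Sum>i\<in>{J (k - 1) + 1..J k - 1}. ref_avg xr i * (ref_diff2 xr f i)\<^sup>2)"
  define A3 where "A3 = (\<Sum>j\<in>{J (k - 1) + 1..J k}. ref_size xr j * (ref_diff xr f j)\<^sup>2)"
  define B where "B = 1 / 128 * (eps N ^ 3 * (lattice_diff N f (lattice_index N xh (k - 1) + 1))\<^sup>2
              + eps N ^ 3 * (lattice_diff N f (lattice_index N xh k + 1))\<^sup>2)\<^sup>2"
  define c where "c = h_hat N xh xr k ^ 4"
  have size: "0 \<le> ref_size xr j" for j using refined_cell_length(1)[of j] by (simp add: ref_size_def)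
  have avg: "0 \<le> ref_avg xr j" for j using size[of j] size[of "j + 1"] by (simp add: ref_avg_def)
  have nn: "0 \<le> A1" "0 \<le> A2" "0 \<le> A3" "0 \<le> B" "0 \<le> c"
    unfolding A1_def A2_def A3_def B_def c_def using size avg by (auto intro!: sum_nonneg)
  have n: "1 \<le> (real (ref_count N K xh) * eps N) ^ 4"
  proof -
    have inj: "inj_on lat {1..int N}" using eps by (auto simp: inj_on_def lattice_pt_def)
    have "N = card (lat ` {1..int N})" using card_image[OF inj] by simp
    also have "\<dots> \<le> ref_count N K xh" unfolding ref_count_def by (intro card_mono) auto
    finally have "1 \<le> real (ref_count N K xh) * eps N" using N by (simp add: eps_def)
    then show ?thesis by (rule one_le_power)
  qed
  have eta: "(eta_ext N K xh xr f k)\<^sup>2 = B + (of_int (J k - J (k - 1)) * eps N / 2)\<^sup>2 * A1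
      + 1 / 64 * (real (ref_count N K xh) * eps N) ^ 4 * c * A2 + c * A3"
  proof -
    have h: "h_tilde N xh xr k = of_int (J k - J (k - 1)) * eps N / 2" by (simp add: h_tilde_def)
    have "0 \<le> B + (of_int (J k - J (k - 1)) * eps N / 2)\<^sup>2 * A1
      + 1 / 64 * (real (ref_count N K xh) * eps N) ^ 4 * c * A2 + c * A3"
      using nn by (intro add_nonneg_nonneg mult_nonneg_nonneg) auto
    then show ?thesis
      unfolding eta_ext_def h D1_def D2_def power2_abs A1_def[symmetric] A2_def[symmetric] A3_def[symmetric]
        B_def[symmetric] c_def[symmetric] by (rule real_sqrt_pow2)
  qed
  have "1 * (c / 64 * A2) \<le> (real (ref_count N K xh) * eps N) ^ 4 * (c / 64 * A2)"
    using n nn by (intro mult_right_mono) auto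
  then show ?thesis unfolding eta A1_def[symmetric] A2_def[symmetric] A3_def[symmetric] c_def[symmetric]
    using nn by simp
qed

text \<open>An element of m refined cells has length h at most m eps and hence at most (m + 1) eps,
  so h^3 is below the numerator in \<open>h_hat\<close>; dividing by h gives the claim for
  squares.\<close>

lemma element_size_le_h_hat:
  assumes k: "element xh k \<subseteq> Oc"
  shows "(xh k - xh (k - 1)) ^ 4 \<le> h_hat N xh xr k ^ 4"
proof -
  define h where "h = xh k - xh (k - 1)"
  define m where "m = (of_int (J k - J (k - 1)) :: real)"
  have h: "0 < h" using xh_less_iff[of "k - 1" k] by (simp add: h_def)
  have J: "J (k - 1) + 2 \<le> J k" by (rule J_step_in_Oc[OF k])
  have "h = (\<Sum>j\<in>{J (k - 1) + 1..J k}. xr j - xr (j - 1))"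
    using sum_telescope_int[of "J (k - 1)" "J k" xr] J by (simp add: h_def)
  also have "\<dots> \<le> (\<Sum>j\<in>{J (k - 1) + 1..J k}. eps N)" by (rule sum_mono) (rule refined_cell_length)
  also have "\<dots> = m * eps N" using J by (simp add: m_def)
  finally have hm: "h \<le> m * eps N" .
  then have "h \<le> (m + 1) * eps N" using eps by (simp add: distrib_right)
  then have "h * h\<^sup>2 \<le> (m * eps N) * ((m + 1) * eps N)\<^sup>2"
    using hm h by (intro mult_mono power_mono) auto
  then have "h\<^sup>2 \<le> m * eps N * ((m + 1) * eps N)\<^sup>2 / h" using h by (simp add: field_simps)
  moreover from this have "(h_hat N xh xr k)\<^sup>2 = m * eps N * ((m + 1) * eps N)\<^sup>2 / h"
    unfolding h_hat_def Let_def h_def[symmetric] m_def[symmetric]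
    by (intro real_sqrt_pow2) (use zero_le_power2[of h] in linarith)
  ultimately have "h\<^sup>2 \<le> (h_hat N xh xr k)\<^sup>2" by simp
  then have "(h\<^sup>2)\<^sup>2 \<le> ((h_hat N xh xr k)\<^sup>2)\<^sup>2" by (rule power_mono) simp
  then show ?thesis unfolding power_mult[symmetric] by (simp add: h_def)
qed

text \<open>The nodal weights are nonnegative with sum 1, so the deviation is a convex combination
  of differences \<open>v x - v (xh k)\<close> of points at distance at most one period.\<close>

lemma nodal_mean_deviation:
  assumes v: "v \<in> P1 lat" "continuous_on UNIV v" "\<And>x. v (x + 1) = v x"
    and unit: "integral {0..1} (\<lambda>x. (deriv v x)\<^sup>2) = 1" and x: "xh 0 \<le> x" "x \<le> xh 0 + 1"
  shows "\<bar>v x - 1 / 2 * (\<Sum>k\<in>{1..int K}. (xh (k + 1) - xh (k - 1)) * v (xh k))\<bar> \<le> 1 / 2"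
proof -
  let ?w = "\<lambda>k. 1 / 2 * (xh (k + 1) - xh (k - 1))"
  have w: "0 \<le> ?w k" for k by simp
  have w1: "(\<Sum>k\<in>{1..int K}. ?w k) = 1"
    using sum_element_trapezoids[of "\<lambda>x. 1"] sum_element_lengths by (simp add: diff_divide_distrib)
  have osc: "\<bar>v x - v (xh k)\<bar> \<le> 1 / 2" if "k \<in> {1..int K}" for k
  proof -
    have "xh 0 \<le> xh k" using that by simp
    then have up: "x \<le> xh k + 1" using x(2) by linarith
    have "xh k \<le> xh (int K)" using that by simp
    moreover have "xh (int K) = xh 0 + 1" using xh_periodic[of 0] by simp
    ultimately have down: "xh k \<le> x + 1" using x(1) by linarith
    show ?thesis
    proof (cases "x \<le> xh k")
      case True
      from periodic_P1_oscillation[OF N v unit this down] show ?thesis by (simp only: abs_minus_commute)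
    next
      case False
      then have "xh k \<le> x" by simp
      from periodic_P1_oscillation[OF N v unit this up] show ?thesis .
    qed
  qed
  have "v x - 1 / 2 * (\<Sum>k\<in>{1..int K}. (xh (k + 1) - xh (k - 1)) * v (xh k))
      = (\<Sum>k\<in>{1..int K}. ?w k) * v x - (\<Sum>k\<in>{1..int K}. ?w k * v (xh k))"
    unfolding w1 by (simp add: sum_distrib_left mult.assoc)
  also have "\<dots> = (\<Sum>k\<in>{1..int K}. ?w k * (v x - v (xh k)))"
    unfolding sum_distrib_right sum_subtractf[symmetric] by (rule sum.cong) (simp_all only: right_diff_distrib)
  also have "\<bar>\<dots>\<bar> \<le> (\<Sum>k\<in>{1..int K}. ?w k * (1 / 2))"
  proof (rule order_trans[OF sum_abs], rule sum_mono)
    fix k assume "k \<in> {1..int K}"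
    then have "?w k * \<bar>v x - v (xh k)\<bar> \<le> ?w k * (1 / 2)" by (rule mult_left_mono[OF osc w])
    then show "\<bar>?w k * (v x - v (xh k))\<bar> \<le> ?w k * (1 / 2)"
      unfolding abs_mult[of "?w k"] abs_of_nonneg[OF w] .
  qed
  also have "\<dots> = 1 / 2" unfolding sum_distrib_right[symmetric] w1 by simp
  finally show ?thesis .
qed

text \<open>Cauchy-Schwarz on each refined cell; the cells of elements 1 to \<open>K\<close> fill
  one period.\<close>

lemma sum_difference_quotients_le:
  assumes v: "v \<in> P1 lat" "continuous_on UNIV v" "\<And>x. v (x + 1) = v x"
  shows "(\<Sum>k\<in>{1..int K}. \<Sum>j\<in>{J (k - 1) + 1..J k}. (v (xr j) - v (xr (j - 1)))\<^sup>2 / ref_size xr j)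
    \<le> integral {0..1} (\<lambda>x. (deriv v x)\<^sup>2)"
proof -
  let ?g = "\<lambda>x. (deriv v x)\<^sup>2"
  note int = integrable_P1_deriv_square[OF N v(1)]
  have "(\<Sum>j\<in>{J 0 + 1..J (int K)}. (v (xr j) - v (xr (j - 1)))\<^sup>2 / ref_size xr j)
      \<le> (\<Sum>j\<in>{J 0 + 1..J (int K)}. integral {xr (j - 1)..xr j} ?g)"
  proof (rule sum_mono)
    fix j
    have "(v (xr j) - v (xr (j - 1)))\<^sup>2 \<le> (xr j - xr (j - 1)) * integral {xr (j - 1)..xr j} ?g"
      by (intro square_increment_le_integral has_integral_P1_deriv[OF N v(1,2)] int) simp_all
    then show "(v (xr j) - v (xr (j - 1)))\<^sup>2 / ref_size xr j \<le> integral {xr (j - 1)..xr j} ?g"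
      using refined_cell_length(1)[of j] by (simp add: ref_size_def field_simps)
  qed
  also have "\<dots> = integral {xr (J 0)..xr (J (int K))} ?g"
    by (intro integral_unique[symmetric] has_integral_partition_int monoD[OF mono_J]
        strict_mono_mono[OF xr_strict_mono] integrable_integral int) simp
  also have "\<dots> = integral {0..1} ?g"
    using integral_unit_interval_periodic[of ?g "xh 0"] int deriv_periodic[of v] v(3) xh_periodic[of 0] by simp
  finally show ?thesis by (simp only: sum_elements)
qed

lemma external_force_error:
  assumes f: "f \<in> lattice_space N" and v: "v \<in> lattice_space N" and unit: "deriv_norm v = 1"
  shows "inner_h K xh f (J_U K xh v) - inner_eps N f v \<le> E_ext N K Oc xh xr f"
proof -
  define V where "V = 1 / 2 * (\<Sum>k\<in>{1..int K}. (xh (k + 1) - xh (k - 1)) * v (xh k))"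
  define w where "w = (\<lambda>x. v x - V)"
  have f': "f \<in> P1 lat" "\<And>x. f (x + 1) = f x" and f0: "integral {0..1} f = 0"
    using f by (auto simp: lattice_space_def)
  have v': "v \<in> P1 lat" "continuous_on UNIV v" "\<And>x. v (x + 1) = v x"
    using v by (auto simp: lattice_space_def)
  have unit': "integral {0..1} (\<lambda>x. (deriv v x)\<^sup>2) = 1"
    using unit by (simp add: deriv_norm_def)
  have w': "w \<in> P1 lat" "\<And>x. w (x + 1) = w x"
  proof -
    show "w \<in> P1 lat" unfolding P1_def w_def
    proof (intro CollectI allI)
      fix k
      obtain a b where "\<forall>x\<in>element lat k. v x = a * x + b" using v'(1) unfolding P1_def by blast
      then have "\<forall>x\<in>element lat k. v x - V = a * x + (b - V)" by auto
      then show "\<exists>a b. \<forall>x\<in>element lat k. v x - V = a * x + b" by blast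
    qed
  qed (simp add: w_def v')
  \<comment> \<open>For the constant function 1 the weighted derivative term vanishes, so the
    lattice sum of f equals its integral, which is 0.\<close>
  have inner_eps_w: "inner_eps N f v = inner_eps N f w"
  proof -
    have "\<forall>x\<in>element lat k. (1 :: real) = 0 * x + 1" for k by simp
    then have "(\<lambda>x. 1 :: real) \<in> P1 lat" unfolding P1_def by blast
    from inner_eps_eq_integral(1)[OF f' this] have "inner_eps N f (\<lambda>x. 1) = 0"
      using f0 by (auto dest: integral_unique)
    then have "(\<Sum>l\<in>{1..int N}. eps N * f (lat l)) * V = 0" by (simp add: inner_eps_def)
    then show ?thesis
      by (simp add: inner_eps_def w_def right_diff_distrib sum_subtractf sum_distrib_right mult.assoc)
  qed
  obtain e where e: "\<forall>k j. element xh k \<subseteq> Oc \<longrightarrow> j \<in> {J (k - 1) + 1..J k} \<longrightarrow> 0 \<le> e j \<and> e j \<le> (eps N)\<^sup>2 / 2"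
    and e_out: "\<forall>k. \<not> element xh k \<subseteq> Oc \<longrightarrow> e (J k) = 0"
    and inner_eps: "inner_eps N f w = (\<Sum>k\<in>{1..int K}. \<Sum>j\<in>{J (k - 1) + 1..J k}.
       ref_size xr j * (f (xr (j - 1)) * w (xr (j - 1)) + f (xr j) * w (xr j)) / 2
         + e j * ref_diff xr f j * (w (xr j) - w (xr (j - 1))))"
    using refined_trapezoids_with_load[OF f' w'] by (elim exE conjE)
  define X where "X = (\<lambda>k. (xh k - xh (k - 1)) * (f (xh (k - 1)) * w (xh (k - 1)) + f (xh k) * w (xh k)) / 2
    - (\<Sum>j\<in>{J (k - 1) + 1..J k}. ref_size xr j * (f (xr (j - 1)) * w (xr (j - 1)) + f (xr j) * w (xr j)) / 2
         + e j * ref_diff xr f j * (w (xr j) - w (xr (j - 1)))))"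
  have error: "inner_h K xh f (J_U K xh v) - inner_eps N f v = (\<Sum>k\<in>{1..int K}. X k)"
    unfolding inner_eps_w inner_eps inner_h_J_U V_def[symmetric] X_def sum_subtractf
    using sum_element_trapezoids[of "\<lambda>x. f x * w x"] f' w' by (simp add: w_def)
  \<comment> \<open>The element is one refined cell, so coarse and refined trapezoid coincide and
    the load is zero.\<close>
  have X_out: "X k = 0" if "\<not> element xh k \<subseteq> Oc" for k
    using e_out that J_step_outside_Oc[OF that] xr_J[of "k - 1"] by (simp add: X_def ref_size_def)
  \<comment> \<open>The share of element \<open>k\<close> in the total budget 1: three quarters for
    the energy of v, one quarter for the length of the period.\<close>
  define \<theta> where "\<theta> = (\<lambda>k. 3 / 4 * (\<Sum>j\<in>{J (k - 1) + 1..J k}. (w (xr j) - w (xr (j - 1)))\<^sup>2 / ref_size xr j)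
    + 1 / 4 * (xh k - xh (k - 1)))"
  have \<theta>: "0 \<le> \<theta> k" for k
  proof -
    have "0 \<le> xh k - xh (k - 1)" by simp
    moreover have "0 \<le> (\<Sum>j\<in>{J (k - 1) + 1..J k}. (w (xr j) - w (xr (j - 1)))\<^sup>2 / ref_size xr j)"
      by (intro sum_nonneg divide_nonneg_nonneg) (use refined_cell_length(1) in \<open>auto simp: ref_size_def less_imp_le\<close>)
    ultimately show ?thesis unfolding \<theta>_def by (intro add_nonneg_nonneg mult_nonneg_nonneg) auto
  qed
  have X_in: "(X k)\<^sup>2 \<le> \<theta> k * (eta_ext N K xh xr f k)\<^sup>2" if k: "element xh k \<subseteq> Oc" "k \<in> {1..int K}" for k
  proof -
    have half: "\<bar>w (xr i)\<bar> \<le> 1 / 2" if "i \<in> {J (k - 1) + 1..J k - 1}" for i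
    proof -
      have "J 0 \<le> J (k - 1)" "J k \<le> J (int K)" using k(2) by (auto intro: monoD[OF mono_J])
      then have "xr (J 0) \<le> xr i" "xr i \<le> xr (J (int K))" using that by (simp_all only: xr_le_iff) auto
      then show ?thesis
        using nodal_mean_deviation[OF v' unit', of "xr i"] xh_periodic[of 0] by (simp add: w_def V_def)
    qed
    have h: "xr (J k) - xr (J (k - 1)) = xh k - xh (k - 1)" by simp
    \<comment> \<open>The element estimate is applied with \<open>\<tau> = eps N\<close> and
      \<open>c = h_hat N xh xr k ^ 4\<close>.\<close>
    have "(X k)\<^sup>2 \<le> \<theta> k *
      ((of_int (J k - J (k - 1)) * eps N / 2)\<^sup>2 * (\<Sum>i\<in>{J (k - 1) + 1..J k - 1}. ref_avg xr i * (f (xr i))\<^sup>2)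
      + h_hat N xh xr k ^ 4 / 64 * (\<Sum>i\<in>{J (k - 1) + 1..J k - 1}. ref_avg xr i * (ref_diff2 xr f i)\<^sup>2)
      + h_hat N xh xr k ^ 4 * (\<Sum>j\<in>{J (k - 1) + 1..J k}. ref_size xr j * (ref_diff xr f j)\<^sup>2))"
      using refined_element_estimate[of "J (k - 1)" "J k" xr "eps N" "\<lambda>j. w (xr j)" e "h_hat N xh xr k ^ 4" "\<lambda>j. f (xr j)",
          OF J_step_in_Oc[OF k(1)] _ refined_cell_length(2) half e[rule_format, OF k(1)]]
        element_length[OF k(1)] element_size_le_h_hat[OF k(1)]
      by (simp add: X_def \<theta>_def ref_size_def ref_diff_def ref_diff2_def ref_avg_def sum.distrib diff_diff_eq)
    also have "\<dots> \<le> \<theta> k * (eta_ext N K xh xr f k)\<^sup>2"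
      by (intro mult_left_mono eta_ext_square_ge[OF k(1)] \<theta>)
    finally show ?thesis .
  qed
  let ?C = "cont_elements K Oc xh"
  have C: "?C = {k \<in> {1..int K}. element xh k \<subseteq> Oc}"
  proof -
    have "element xh k \<inter> {0..1} \<noteq> {} \<and> element xh k \<inter> {1<..} = {}" if "k \<in> {1..int K}" for k
    proof -
      have "xh k \<in> {0<..1}" using that xh_period[of k] by simp
      then have "xh k \<in> element xh k \<inter> {0..1}" "element xh k \<inter> {1<..} = {}" by (auto simp: element_def)
      then show ?thesis by blast
    qed
    then show ?thesis unfolding cont_elements_def by auto
  qed
  have "(\<Sum>k\<in>{1..int K}. X k) = (\<Sum>k\<in>?C. X k)"
    unfolding C by (rule sum.mono_neutral_right) (use X_out in auto)
  also have "\<dots> \<le> (\<Sum>k\<in>?C. sqrt (\<theta> k) * \<bar>eta_ext N K xh xr f k\<bar>)"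
  proof (rule sum_mono)
    fix k assume "k \<in> ?C"
    then have "(X k)\<^sup>2 \<le> \<theta> k * (eta_ext N K xh xr f k)\<^sup>2" using X_in[of k] unfolding C by blast
    also have "\<dots> = (sqrt (\<theta> k) * \<bar>eta_ext N K xh xr f k\<bar>)\<^sup>2"
      using \<theta>[of k] by (simp add: power_mult_distrib)
    finally show "X k \<le> sqrt (\<theta> k) * \<bar>eta_ext N K xh xr f k\<bar>"
      by (rule power2_le_imp_le) (use \<theta>[of k] in auto)
  qed
  \<comment> \<open>Cauchy-Schwarz over the elements; the first factor is then at most 1.\<close>
  also have "\<dots> \<le> sqrt (\<Sum>k\<in>?C. \<theta> k) * sqrt (\<Sum>k\<in>?C. (eta_ext N K xh xr f k)\<^sup>2)"
    using L2_set_mult_ineq[of "\<lambda>k. sqrt (\<theta> k)" "eta_ext N K xh xr f" ?C] \<theta> by (simp add: L2_set_def)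
  also have "\<dots> \<le> 1 * sqrt (\<Sum>k\<in>?C. (eta_ext N K xh xr f k)\<^sup>2)"
  proof (rule mult_right_mono)
    have "(\<Sum>k\<in>?C. \<theta> k) \<le> (\<Sum>k\<in>{1..int K}. \<theta> k)" unfolding C by (rule sum_mono2) (use \<theta> in auto)
    also have "\<dots> = 3 / 4 * (\<Sum>k\<in>{1..int K}. \<Sum>j\<in>{J (k - 1) + 1..J k}. (v (xr j) - v (xr (j - 1)))\<^sup>2 / ref_size xr j)
        + 1 / 4 * (\<Sum>k\<in>{1..int K}. xh k - xh (k - 1))"
      unfolding \<theta>_def sum.distrib sum_distrib_left by (simp add: w_def)
    also have "\<dots> \<le> 3 / 4 * 1 + 1 / 4 * 1"
      using sum_difference_quotients_le[OF v'] unit' sum_element_lengths by linarith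
    finally show "sqrt (\<Sum>k\<in>?C. \<theta> k) \<le> 1" by simp
  qed (simp add: sum_nonneg)
  finally show ?thesis unfolding error E_ext_def by simp
qed

end

theorem theorem5:
  fixes N K :: nat and Oa Oc :: "real set" and xh xr :: "int \<Rightarrow> real" and f :: "real \<Rightarrow> real"
  assumes "N \<ge> 1"
    and "regions N Oa Oc"
    and "fe_mesh N K Oa Oc xh"
    and "is_common_refinement N xh xr"
    and "f \<in> lattice_space N"
  shows "dual_norm N (\<lambda>v. inner_h K xh f (J_U K xh v) - inner_eps N f v)
           \<le> ereal (E_ext N K Oc xh xr f)"
proof -
  interpret refined_mesh N K Oa Oc xh xr using assms by unfold_locales
  show ?thesis unfolding dual_norm_def
    by (rule SUP_least) (use external_force_error[OF assms(5)] in auto)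
qed

end
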